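(* Let $c>0$, let $T_N^*$ be the stopping time of the greedy exploration algorithm on the Erdős–Rényi graph $G(N,c/N)$ (equivalently, the size of the independent set it constructs), and let $T^*=\frac1c\log(1+c)$. Let $T_{\alpha_0}$ and $F(\alpha_0)$, $\alpha_0\in\mathbb R$, be as defined in the context. (1) If $\varepsilon>0$ is such that $T^*+\varepsilon<1$, then $$\lim_{N\to\infty}\frac1N\log\mathbb P\left(\frac{T_N^*}{N}\ge T^*+\varepsilon\right)=-F\big(\alpha_0(T^*+\varepsilon)\big),$$ where $\alpha_0(T^*+\varepsilon)$ is the unique real number $\alpha_0<0$ such that $T_{\alpha_0}=T^*+\varepsilon$. (2) If $\varepsilon>0$ is such that $T^*-\varepsilon>0$, then $$\lim_{N\to\infty}\frac1N\log\mathbb P\left(\frac{T_N^*}{N}\le T^*-\varepsilon\right)=-F\big(\alpha_0(T^*-\varepsilon)\big),$$ where $\alpha_0(T^*-\varepsilon)$ is the unique real number $\alpha_0>0$ such that $T_{\alpha_0}=T^*-\varepsilon$.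
   Context: Greedy exploration algorithm on $G(N,c/N)$ (the random graph on $N$ vertices in which each edge is present independently with probability $c/N$): initially all vertices are unexplored. At each step a vertex is selected uniformly among the unexplored ones and becomes active; all its unexplored neighbours become blocked. Active and blocked vertices are called explored. $Z^N_k$ is the number of explored vertices after step $k$, and $T_N^*$ is the first step $k$ at which $Z^N_k=N$. $\{Z^N_k\}_k$ is a time-homogeneous Markov chain on $\{0,1,\dots,N\}$ with $Z^N_0=0$, absorbed at $N$, and such that, when $Z^N_k<N$, $Z^N_{k+1}=Z^N_k+1+\zeta^N_{k+1}$, where conditionally on $Z^N_k$ the variable $\zeta^N_{k+1}$ is Binomial with parameters $N-Z^N_k-1$ and $c/N$. Cost function: $L(x,\beta)=(\beta-1)\left[\log\left(\frac{\beta-1}{c(1-x)}\right)-1\right]+c(1-x)$ if $x<1,\beta>1$; $L(x,\beta)=c(1-x)$ if $x<1,\beta=1$; $L(1,0)=0$; and $L=+\infty$ in all other cases ($x\in[0,1]$, $\beta\in\mathbb R$). For $\alpha_0\in\mathbb R$, $x_{\alpha_0}$ is the $x$-component of the solution of $$\dot x=1+c(1-x)e^{\alpha},\ x(0)=0;\qquad \dot\alpha=c(e^{\alpha}-1),\ \alpha(0)=\alpha_0,$$ $T_{\alpha_0}=\inf\{t\in[0,1]:x_{\alpha_0}(t)\ge 1\}$, and $F(\alpha_0)=\int_0^{T_{\alpha_0}}L\big(x_{\alpha_0}(t),\dot x_{\alpha_0}(t)\big)\,dt$. *)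

theory Defs
  imports "HOL-Probability.Probability"
begin

text \<open>
  The random graph on the vertices \<open>{..<N}\<close>, given by its set of edges. For \<open>p > 1\<close>
  (that is, \<open>c / N > 1\<close>, which concerns finitely many \<open>N\<close> only), \<open>bernoulli_pmf p\<close>
  is the point mass at \<open>True\<close>.
\<close>

definition erdos_renyi :: "nat \<Rightarrow> real \<Rightarrow> nat set set pmf" where
  "erdos_renyi N p =
     map_pmf Collect (Pi_pmf {e. e \<subseteq> {..<N} \<and> card e = 2} False (\<lambda>_. bernoulli_pmf p))"

text \<open>
  A state \<open>(A, B)\<close> of the exploration consists of the set \<open>A\<close> of active and the set \<open>B\<close> of
  blocked vertices.
\<close>

type_synonym state = "nat set \<times> nat set"

definition explored :: "state \<Rightarrow> nat set" where
  "explored s = fst s \<union> snd s"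

definition unexplored :: "nat \<Rightarrow> state \<Rightarrow> nat set" where
  "unexplored N s = {..<N} - explored s"

definition greedy_step :: "nat \<Rightarrow> nat set set \<Rightarrow> state \<Rightarrow> state pmf" where
  "greedy_step N E s =
     (if unexplored N s = {} then return_pmf s
      else map_pmf (\<lambda>v. (insert v (fst s), snd s \<union> {w \<in> unexplored N s. {v, w} \<in> E}))
             (pmf_of_set (unexplored N s)))"

text \<open>The list of the states after steps \<open>0, \<dots>, k\<close> on a graph with edge set \<open>E\<close>.\<close>

primrec greedy_path :: "nat \<Rightarrow> nat set set \<Rightarrow> nat \<Rightarrow> state list pmf" where
  "greedy_path N E 0 = return_pmf [({}, {})]"
| "greedy_path N E (Suc k) =
     bind_pmf (greedy_path N E k) (\<lambda>ss.
       map_pmf (\<lambda>s. ss @ [s]) (greedy_step N E (last ss)))"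

text \<open>
  The exploration of the random graph. Every step explores at least one new vertex as long as
  there is one, so that \<open>N\<close> steps always suffice.
\<close>

definition greedy_exploration :: "nat \<Rightarrow> real \<Rightarrow> state list pmf" where
  "greedy_exploration N p = bind_pmf (erdos_renyi N p) (\<lambda>E. greedy_path N E N)"

definition num_explored :: "state list \<Rightarrow> nat \<Rightarrow> nat" where
  "num_explored ss k = card (explored (ss ! k))"

definition stop_time :: "nat \<Rightarrow> state list \<Rightarrow> nat" where
  "stop_time N ss = (LEAST k. num_explored ss k = N)"

definition log_prob :: "'a pmf \<Rightarrow> 'a set \<Rightarrow> ereal" where
  "log_prob M A =
     (if measure_pmf.prob M A = 0 then -\<infinity> else ereal (ln (measure_pmf.prob M A)))"

definition cost :: "real \<Rightarrow> real \<Rightarrow> real \<Rightarrow> ereal" where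
  "cost c x \<beta> =
     (if x < 1 \<and> \<beta> > 1 then
        ereal ((\<beta> - 1) * (ln ((\<beta> - 1) / (c * (1 - x))) - 1) + c * (1 - x))
      else if x < 1 \<and> \<beta> = 1 then ereal (c * (1 - x))
      else if x = 1 \<and> \<beta> = 0 then 0
      else \<infinity>)"

definition ode_solution ::
    "real \<Rightarrow> real \<Rightarrow> real \<Rightarrow> (real \<Rightarrow> real) \<Rightarrow> (real \<Rightarrow> real) \<Rightarrow> bool" where
  "ode_solution c a t x \<alpha> \<longleftrightarrow>
     x 0 = 0 \<and> \<alpha> 0 = a \<and>
     (\<forall>s\<in>{0..t}.
        (x has_real_derivative 1 + c * (1 - x s) * exp (\<alpha> s)) (at s within {0..t}) \<and>
        (\<alpha> has_real_derivative c * (exp (\<alpha> s) - 1)) (at s within {0..t}))"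

text \<open>
  For \<open>a > 0\<close> the solution explodes at a finite time, possibly before time \<open>1\<close> (but only after
  \<open>x\<close> has reached \<open>1\<close>). The function \<open>x_sol c a\<close> is therefore meaningful at the times \<open>t\<close>
  such that the solution exists on \<open>[0, t]\<close>, and only these times are considered in \<open>hit_time\<close>.
\<close>

definition x_sol :: "real \<Rightarrow> real \<Rightarrow> real \<Rightarrow> real" where
  "x_sol c a t = (THE v. \<exists>x \<alpha>. ode_solution c a t x \<alpha> \<and> v = x t)"

definition hit_time :: "real \<Rightarrow> real \<Rightarrow> real" where
  "hit_time c a =
     Inf {t \<in> {0..1}. (\<exists>x \<alpha>. ode_solution c a t x \<alpha>) \<and> x_sol c a t \<ge> 1}"

text \<open>
  The cost is nonnegative on \<open>[0, 1] \<times> \<real>\<close>, so that the truncation at \<open>0\<close> performed by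
  \<open>e2ennreal\<close> has no effect. The end points of the interval of integration, where \<open>deriv\<close> need
  not be the one-sided derivative or the cost is infinite, form a null set.
\<close>

definition path_cost :: "real \<Rightarrow> real \<Rightarrow> ereal" where
  "path_cost c a =
     enn2ereal (\<integral>\<^sup>+t\<in>{0..hit_time c a}. e2ennreal (cost c (x_sol c a t) (deriv (x_sol c a) t)) \<partial>lborel)"

end

theory Submission
  imports Defs "HOL-Real_Asymp.Real_Asymp"
begin

text \<open>
  The number of explored vertices is a Markov chain with binomial jumps, and the tail
  probabilities \<open>P(T\<^sub>N \<ge> k)\<close> of its absorption time satisfy the recursion of a pure birth
  chain: inspecting the vertices one by one, the next one joins the independent set of current
  size \<open>k\<close> with probability \<open>q\<^sup>k\<close>, \<open>q = 1 - c / N\<close>. Thus \<open>T\<^sub>N \<ge> k\<close> says that a sum of \<open>k\<close>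
  independent geometric variables is at most \<open>N\<close>, and the functions \<open>e\<^sup>-\<^sup>\<theta>\<^sup>n\<close> times the moment
  generating function of this sum at \<open>\<theta>\<close> solve the recursion exactly. As the recursion is
  monotone, comparison with one such solution gives the Chernoff upper bound, and
  comparison with a combination of three of them gives the matching lower bound. The Hamiltonian
  system is solved explicitly, and along its solution the cost integrates to the Legendre transform
  of the limiting logarithmic moment generating function, the optimal \<open>\<theta>\<close> being \<open>\<alpha>\<^sub>0\<close>.
\<close>

section \<open>The recursion for the tail probabilities\<close>

text \<open>The events concern only the absorption time, so no large deviation principle for paths
  is proved; the differential equation serves to identify the exponent. The obstacle is the lower
  bound. The optimal parameter \<open>a\<close> is a critical point of the exponent
  \<open>rate\<close>: waves with parameters beyond \<open>a\<close>, seen from 0, are exponentially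
  larger than the wave at \<open>a\<close>, but this growth has derivative zero at \<open>a\<close>.
  The main wave therefore sits at \<theta>1 slightly beyond \<open>a\<close>. The wave at
  \<open>a\<close> is then negligible and cancels the main one on one side of the boundary. On the
  other side a wave at \<theta>2, further out, cancels it past a cutoff. The cutoff is a small
  multiple of N; it adds to the exponent a term with nonzero derivative at \<open>a\<close>, which
  beats the growth and makes the weighted \<theta>2 wave negligible as well. Its cost vanishes with
  the cutoff.\<close>

fun tail :: "real \<Rightarrow> nat \<Rightarrow> nat \<Rightarrow> real" where
  "tail q n 0 = 1"
| "tail q 0 (Suc k) = 0"
| "tail q (Suc n) (Suc k) = (1 - q ^ k) * tail q n (Suc k) + q ^ k * tail q n k"

text \<open>For a chain X with birth probability \<open>q ^ k\<close> in state k, P(X = k) is a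
  difference of two tails, which turns the forward equation into this convex combination. The bound
  \<open>K\<close> is there because a wave with \<theta> > 0 is controlled only while
  \<open>mgf_denom\<close> stays positive.\<close>

definition solves :: "real \<Rightarrow> nat \<Rightarrow> (nat \<Rightarrow> nat \<Rightarrow> real) \<Rightarrow> bool" where
  "solves q K f \<longleftrightarrow> (\<forall>n. \<forall>k<K. f (Suc n) (Suc k) = (1 - q ^ k) * f n (Suc k) + q ^ k * f n k)"

lemma solves_tail: "solves q K (tail q)"
  by (simp add: solves_def)

lemma solves_const: "solves q K (\<lambda>_ _. a)"
  by (simp add: solves_def algebra_simps)

lemma solves_diff: "solves q K f \<Longrightarrow> solves q K g \<Longrightarrow> solves q K (\<lambda>n k. f n k - g n k)"
  by (simp add: solves_def algebra_simps)

lemma solves_scale: "solves q K f \<Longrightarrow> solves q K (\<lambda>n k. a * f n k)"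
  unfolding solves_def by (metis (no_types, opaque_lifting) distrib_left mult.left_commute)

text \<open>A discrete maximum principle: the weights \<open>1 - q ^ j\<close> and
  \<open>q ^ j\<close> are nonnegative, so an order on the boundary, k = 0 and n = 0, propagates
  inwards.\<close>

lemma solves_mono:
  assumes "solves q K f" "solves q K g" "0 \<le> q" "q \<le> 1"
    and "\<And>n. f n 0 \<le> g n 0" and "\<And>k. k \<le> K \<Longrightarrow> f 0 k \<le> g 0 k"
    and "k \<le> K"
  shows "f n k \<le> g n k"
  using assms(7)
proof (induction n arbitrary: k)
  case 0
  then show ?case by (rule assms(6))
next
  case (Suc n)
  show ?case
  proof (cases k)
    case 0
    then show ?thesis by (simp add: assms(5))
  next
    case (Suc j)
    have "0 \<le> q ^ j" "q ^ j \<le> 1" using assms(3,4) by (auto intro: power_le_one)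
    then have "(1 - q ^ j) * f n k + q ^ j * f n j \<le> (1 - q ^ j) * g n k + q ^ j * g n j"
      using Suc.IH Suc.prems Suc by (intro add_mono mult_left_mono) auto
    then show ?thesis
      using assms(1,2) Suc.prems Suc by (simp add: solves_def)
  qed
qed

text \<open>
  The moment generating function at \<open>\<theta>\<close> of a geometric variable on \<open>{1, 2, \<dots>}\<close> with success
  probability \<open>q\<^sup>j\<close> is \<open>1 / mgf_denom q \<theta> j\<close>, as long as this is positive.
\<close>

definition mgf_denom :: "real \<Rightarrow> real \<Rightarrow> nat \<Rightarrow> real" where
  "mgf_denom q \<theta> j = 1 + (exp (- \<theta>) - 1) / q ^ j"

definition mgf :: "real \<Rightarrow> real \<Rightarrow> nat \<Rightarrow> real" where
  "mgf q \<theta> k = (\<Prod>j<k. 1 / mgf_denom q \<theta> j)"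

definition wave :: "real \<Rightarrow> real \<Rightarrow> nat \<Rightarrow> nat \<Rightarrow> real" where
  "wave q \<theta> n k = exp (- \<theta> * n) * mgf q \<theta> k"

context
  fixes q :: real assumes q: "0 < q" "q \<le> 1"
begin

lemma mgf_denom_antimono: "\<theta> \<le> \<theta>' \<Longrightarrow> mgf_denom q \<theta>' j \<le> mgf_denom q \<theta> j"
  using q by (simp add: mgf_denom_def divide_right_mono)

lemma mgf_denom_nonpos: "\<theta> \<le> 0 \<Longrightarrow> 1 \<le> mgf_denom q \<theta> j"
  using q by (simp add: mgf_denom_def)

lemma mgf_denom_nonneg: "0 \<le> \<theta> \<Longrightarrow> mgf_denom q \<theta> j \<le> 1"
  using q by (simp add: mgf_denom_def divide_le_0_iff)

lemma mgf_pos: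
  assumes "\<And>j. j < K \<Longrightarrow> 0 < mgf_denom q \<theta> j" and "k \<le> K"
  shows "0 < mgf q \<theta> k"
  unfolding mgf_def using assms by (intro prod_pos) auto

lemma solves_wave:
  assumes "\<And>j. j < K \<Longrightarrow> 0 < mgf_denom q \<theta> j"
  shows "solves q K (wave q \<theta>)"
  unfolding solves_def
proof (intro allI impI)
  fix n k assume "k < K"
  then have d: "0 < mgf_denom q \<theta> k" by (rule assms)
  \<comment> \<open>By definition \<open>q ^ k * mgf_denom q \<theta> k = q ^ k - 1 + exp (-
    \<theta>)\<close>. Divided by \<open>mgf_denom\<close>, this is what the recursion demands of a
    product solution.\<close>
  have "exp (- \<theta>) / mgf_denom q \<theta> k = (1 - q ^ k) / mgf_denom q \<theta> k + q ^ k"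
    using d q by (simp add: field_simps) (simp add: mgf_denom_def field_simps)
  then have "exp (- \<theta> * real n) * mgf q \<theta> k * (exp (- \<theta>) / mgf_denom q \<theta> k)
      = exp (- \<theta> * real n) * mgf q \<theta> k * ((1 - q ^ k) / mgf_denom q \<theta> k + q ^ k)"
    by (rule arg_cong)
  moreover have "exp (- \<theta> * real (Suc n)) = exp (- \<theta> * real n) * exp (- \<theta>)"
    by (simp add: algebra_simps flip: exp_add)
  ultimately show "wave q \<theta> (Suc n) (Suc k) = (1 - q ^ k) * wave q \<theta> n (Suc k) + q ^ k * wave q \<theta> n k"
    by (simp add: wave_def mgf_def algebra_simps)
qed

lemma mgf_mono:
  assumes "\<theta> \<le> \<theta>'" and "\<And>j. j < K \<Longrightarrow> 0 < mgf_denom q \<theta>' j" and "k \<le> K"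
  shows "mgf q \<theta> k \<le> mgf q \<theta>' k"
  unfolding mgf_def
proof (rule prod_mono)
  fix j assume "j \<in> {..<k}"
  then have d: "0 < mgf_denom q \<theta>' j" using assms by auto
  with mgf_denom_antimono[OF assms(1), of j] have "0 < mgf_denom q \<theta> j" by linarith
  with d show "0 \<le> 1 / mgf_denom q \<theta> j \<and> 1 / mgf_denom q \<theta> j \<le> 1 / mgf_denom q \<theta>' j"
    using mgf_denom_antimono[OF assms(1), of j] by (auto intro: divide_left_mono)
qed

text \<open>On k = 0, where the tail is 1, the wave is exp(-\<theta> n) >= 1 by the sign of
  \<theta>; on n = 0 the tail vanishes for positive k and the wave is positive.\<close>

lemma tail_le_wave:
  assumes "\<theta> \<le> 0"
  shows "tail q n k \<le> wave q \<theta> n k"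
proof -
  have d: "0 < mgf_denom q \<theta> j" for j
    using mgf_denom_nonpos[OF assms, of j] by linarith
  show ?thesis
  proof (rule solves_mono[where K = k])
    show "solves q k (wave q \<theta>)" by (rule solves_wave) (rule d)
    show "tail q n 0 \<le> wave q \<theta> n 0" for n
      using assms by (simp add: wave_def mgf_def mult_nonpos_nonneg)
    show "tail q 0 j \<le> wave q \<theta> 0 j" for j
      using mgf_pos[OF d, of j j] by (cases j) (simp_all add: wave_def mgf_def)
  qed (use q in \<open>auto simp: solves_tail\<close>)
qed

lemma one_le_mgf:
  assumes "0 \<le> \<theta>" and "\<And>j. j < K \<Longrightarrow> 0 < mgf_denom q \<theta> j" and "k \<le> K"
  shows "1 \<le> mgf q \<theta> k"
  unfolding mgf_def using assms mgf_denom_nonneg[OF assms(1)]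
  by (intro prod_ge_1) auto

lemma head_le_wave:
  assumes "0 \<le> \<theta>" and d: "\<And>j. j < k \<Longrightarrow> 0 < mgf_denom q \<theta> j"
  shows "1 - tail q n k \<le> wave q \<theta> n k"
proof (rule solves_mono[where K = k])
  show "solves q k (wave q \<theta>)" by (rule solves_wave) (rule d)
  show "solves q k (\<lambda>n k. 1 - tail q n k)"
    by (intro solves_diff solves_const solves_tail)
  show "1 - tail q n 0 \<le> wave q \<theta> n 0" for n
    by (simp add: wave_def mgf_def)
  show "1 - tail q 0 j \<le> wave q \<theta> 0 j" if "j \<le> k" for j
    using one_le_mgf[OF assms that] by (cases j) (simp_all add: wave_def)
qed (use q in auto)

text \<open>
  Subtracting the waves for \<open>\<theta>\<^sub>2\<close> and \<open>\<theta>\<^sub>3\<close> makes the boundary values nonpositive except where \<open>n\<close> is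
  small; this plays the role of the localisation under the tilted measure.
\<close>

lemma wave_le_tail:
  assumes "\<theta>2 \<le> \<theta>1" "\<theta>1 \<le> \<theta>3" "\<theta>3 \<le> 0"
  shows "exp (\<theta>1 * r) * (wave q \<theta>1 n k - exp (- (\<theta>1 - \<theta>2) * r) * wave q \<theta>2 n k - wave q \<theta>3 n k)
    \<le> tail q n k"
proof -
  have d: "0 < mgf_denom q \<theta> j" if "\<theta> \<le> 0" for \<theta> j
    using mgf_denom_nonpos[OF that, of j] by linarith
  show ?thesis
  proof (rule solves_mono[where K = k and f = "\<lambda>n k. exp (\<theta>1 * r) * (wave q \<theta>1 n k
      - exp (- (\<theta>1 - \<theta>2) * r) * wave q \<theta>2 n k - wave q \<theta>3 n k)"])
    show "solves q k (\<lambda>n k. exp (\<theta>1 * r) * (wave q \<theta>1 n k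
      - exp (- (\<theta>1 - \<theta>2) * r) * wave q \<theta>2 n k - wave q \<theta>3 n k))"
      by (intro solves_scale solves_diff solves_wave d) (use assms in auto)
    show "exp (\<theta>1 * r) * (wave q \<theta>1 n 0 - exp (- (\<theta>1 - \<theta>2) * r) * wave q \<theta>2 n 0 - wave q \<theta>3 n 0)
        \<le> tail q n 0" for n
    \<comment> \<open>On k = 0 every \<open>mgf\<close> is 1. Up to the cutoff \<open>r\<close> the
      prefactor brings the main term exp(-\<theta>1 n) to at most 1; beyond it, (\<theta>1 -
      \<theta>2) (n - r) >= 0 lets the \<theta>2 term absorb the main one.\<close>
    proof (cases "n \<le> r")
      case True
      have "exp (\<theta>1 * r) * (wave q \<theta>1 n 0 - exp (- (\<theta>1 - \<theta>2) * r) * wave q \<theta>2 n 0 - wave q \<theta>3 n 0)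
          \<le> exp (\<theta>1 * r) * wave q \<theta>1 n 0"
      proof (rule mult_left_mono)
        have "0 \<le> exp (- (\<theta>1 - \<theta>2) * r) * wave q \<theta>2 n 0" "0 \<le> wave q \<theta>3 n 0"
          by (simp_all add: wave_def mgf_def)
        then show "wave q \<theta>1 n 0 - exp (- (\<theta>1 - \<theta>2) * r) * wave q \<theta>2 n 0 - wave q \<theta>3 n 0 \<le> wave q \<theta>1 n 0"
          by linarith
      qed simp
      also have "\<dots> = exp (\<theta>1 * (r - n))"
        by (simp add: wave_def mgf_def algebra_simps flip: exp_add)
      also have "\<dots> \<le> 1" using True assms by (simp add: mult_nonpos_nonneg)
      finally show ?thesis by simp
    next
      case False
      then have "(\<theta>1 - \<theta>2) * r \<le> (\<theta>1 - \<theta>2) * n"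
        using assms by (intro mult_left_mono) auto
      then have "wave q \<theta>1 n 0 \<le> exp (- (\<theta>1 - \<theta>2) * r) * wave q \<theta>2 n 0"
        by (simp add: wave_def mgf_def algebra_simps flip: exp_add)
      moreover have "0 \<le> wave q \<theta>3 n 0" by (simp add: wave_def mgf_def)
      ultimately have "wave q \<theta>1 n 0 - exp (- (\<theta>1 - \<theta>2) * r) * wave q \<theta>2 n 0 - wave q \<theta>3 n 0 \<le> 0"
        by linarith
      then have "exp (\<theta>1 * r) * (wave q \<theta>1 n 0 - exp (- (\<theta>1 - \<theta>2) * r) * wave q \<theta>2 n 0 - wave q \<theta>3 n 0) \<le> 0"
        by (simp add: mult_nonneg_nonpos)
      then show ?thesis by simp
    qed
    \<comment> \<open>On n = 0 only the \<open>mgf\<close> factors remain, and they increase with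
      \<theta>: the \<theta>3 wave absorbs the main one.\<close>
    show "exp (\<theta>1 * r) * (wave q \<theta>1 0 j - exp (- (\<theta>1 - \<theta>2) * r) * wave q \<theta>2 0 j - wave q \<theta>3 0 j)
        \<le> tail q 0 j" for j
    proof -
      have "mgf q \<theta>1 j \<le> mgf q \<theta>3 j"
        using assms d by (intro mgf_mono[where K = j]) auto
      moreover have "0 < mgf q \<theta>2 j"
        using assms d by (intro mgf_pos[where K = j]) auto
      ultimately have "mgf q \<theta>1 j - exp (- (\<theta>1 - \<theta>2) * r) * mgf q \<theta>2 j - mgf q \<theta>3 j \<le> 0"
        by (smt (verit) exp_gt_zero mult_pos_pos)
      then have "exp (\<theta>1 * r) * (wave q \<theta>1 0 j - exp (- (\<theta>1 - \<theta>2) * r) * wave q \<theta>2 0 j - wave q \<theta>3 0 j) \<le> 0"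
        by (simp add: wave_def mult_nonneg_nonpos)
      moreover have "0 \<le> tail q 0 j" by (cases j) auto
      ultimately show ?thesis by linarith
    qed
  qed (use q in \<open>auto simp: solves_tail\<close>)
qed

text \<open>Every factor of the ratio is at least 1 since \<open>mgf_denom\<close> decreases in
  \<theta>. This makes a wave with larger \<theta> take over past a given index.\<close>

lemma mgf_ratio_mono:
  assumes "\<theta> \<le> \<theta>'" and d: "\<And>j. j < K \<Longrightarrow> 0 < mgf_denom q \<theta>' j" and "i \<le> k" "k \<le> K"
  shows "mgf q \<theta>' i / mgf q \<theta> i \<le> mgf q \<theta>' k / mgf q \<theta> k"
proof -
  have pos: "0 < mgf_denom q \<theta> j" if "j < K" for j
    using d[OF that] mgf_denom_antimono[OF assms(1), of j] by linarith
  have "mgf q \<theta>' k / mgf q \<theta> k = (\<Prod>j<k. mgf_denom q \<theta> j / mgf_denom q \<theta>' j)" for k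
    by (simp add: mgf_def prod_dividef)
  moreover have "(\<Prod>j<i. mgf_denom q \<theta> j / mgf_denom q \<theta>' j) \<le> (\<Prod>j<k. mgf_denom q \<theta> j / mgf_denom q \<theta>' j)"
  proof (rule prod_mono2)
    fix j assume "j \<in> {..<k} - {..<i}"
    then have "0 < mgf_denom q \<theta>' j" using assms by auto
    then show "1 \<le> mgf_denom q \<theta> j / mgf_denom q \<theta>' j"
      using mgf_denom_antimono[OF assms(1), of j] by simp
  next
    fix j assume "j \<in> {..<i}"
    then show "0 \<le> mgf_denom q \<theta> j / mgf_denom q \<theta>' j"
      using assms pos by (auto intro!: divide_nonneg_pos less_imp_le[OF pos])
  qed (use assms in auto)
  ultimately show ?thesis by simp
qed

text \<open>Mirror image of \<open>wave_le_tail\<close>, with the cutoff on the other side. On k = 0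
  the \<theta>3 wave absorbs the main one. On n = 0 the main one is at most
  \<open>mgf q \<theta>1 i\<close> up to the index \<open>i\<close>, hence the normalisation, and
  past \<open>i\<close> it is absorbed by the \<theta>2 wave, whose coefficient makes the two equal
  at \<open>i\<close>.\<close>

lemma wave_le_head:
  assumes "0 \<le> \<theta>3" "\<theta>3 \<le> \<theta>1" "\<theta>1 \<le> \<theta>2"
    and d2: "\<And>j. j < k \<Longrightarrow> 0 < mgf_denom q \<theta>2 j" and "i \<le> k"
  shows "(wave q \<theta>1 n k - wave q \<theta>3 n k - mgf q \<theta>1 i / mgf q \<theta>2 i * wave q \<theta>2 n k) / mgf q \<theta>1 i
    \<le> 1 - tail q n k"
proof -
  have d: "0 < mgf_denom q \<theta> j" if "\<theta> \<le> \<theta>2" "j < k" for \<theta> j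
    using mgf_denom_antimono[OF that(1), of j] d2[OF that(2)] by linarith
  have pos: "0 < mgf q \<theta> j" if "\<theta> \<le> \<theta>2" "j \<le> k" for \<theta> j
    by (rule mgf_pos[OF d]) (use that in auto)
  have pos1: "0 < mgf q \<theta>1 i" using pos assms by auto
  show ?thesis
  proof (rule solves_mono[where K = k and f = "\<lambda>n k. (wave q \<theta>1 n k - wave q \<theta>3 n k
        - mgf q \<theta>1 i / mgf q \<theta>2 i * wave q \<theta>2 n k) / mgf q \<theta>1 i"
        and g = "\<lambda>n k. 1 - tail q n k"])
    show "solves q k (\<lambda>n k. 1 - tail q n k)"
      by (intro solves_diff solves_const solves_tail)
    have "solves q k (\<lambda>n k. inverse (mgf q \<theta>1 i) * (wave q \<theta>1 n k - wave q \<theta>3 n k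
        - mgf q \<theta>1 i / mgf q \<theta>2 i * wave q \<theta>2 n k))"
      by (intro solves_scale solves_diff solves_wave d) (use assms in auto)
    then show "solves q k (\<lambda>n k. (wave q \<theta>1 n k - wave q \<theta>3 n k
        - mgf q \<theta>1 i / mgf q \<theta>2 i * wave q \<theta>2 n k) / mgf q \<theta>1 i)"
      by (simp add: field_simps)
    show "(wave q \<theta>1 n 0 - wave q \<theta>3 n 0 - mgf q \<theta>1 i / mgf q \<theta>2 i * wave q \<theta>2 n 0) / mgf q \<theta>1 i
        \<le> 1 - tail q n 0" for n
    proof -
      have "wave q \<theta>1 n 0 \<le> wave q \<theta>3 n 0"
        using assms by (simp add: wave_def mgf_def mult_right_mono)
      moreover have "0 \<le> mgf q \<theta>1 i / mgf q \<theta>2 i * wave q \<theta>2 n 0"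
        using pos[of \<theta>1 i] pos[of \<theta>2 i] assms by (simp add: wave_def mgf_def[of q \<theta>2 0])
      ultimately show ?thesis using pos1 by (simp add: divide_le_0_iff)
    qed
    show "(wave q \<theta>1 0 j - wave q \<theta>3 0 j - mgf q \<theta>1 i / mgf q \<theta>2 i * wave q \<theta>2 0 j) / mgf q \<theta>1 i
        \<le> 1 - tail q 0 j" if j: "j \<le> k" for j
    proof -
      have p: "0 < mgf q \<theta>1 j" "0 < mgf q \<theta>2 j" "0 < mgf q \<theta>3 j" "0 < mgf q \<theta>2 i"
        using pos j assms by auto
      have "mgf q \<theta>1 j \<le> mgf q \<theta>1 i + mgf q \<theta>1 i / mgf q \<theta>2 i * mgf q \<theta>2 j"
      proof (cases "j \<le> i")
        case True
        have d1: "mgf_denom q \<theta>1 l \<le> 1" for l using assms by (intro mgf_denom_nonneg) auto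
        have "mgf q \<theta>1 j \<le> mgf q \<theta>1 i"
          unfolding mgf_def
          by (rule prod_mono2) (use True assms d[of \<theta>1] d1 in \<open>auto intro: less_imp_le\<close>)
        then show ?thesis using p pos1 by (smt (verit) divide_pos_pos mult_pos_pos)
      next
        case False
        then have "mgf q \<theta>2 i / mgf q \<theta>1 i \<le> mgf q \<theta>2 j / mgf q \<theta>1 j"
          using assms j by (intro mgf_ratio_mono[where K = k]) auto
        then have "mgf q \<theta>1 j \<le> mgf q \<theta>1 i / mgf q \<theta>2 i * mgf q \<theta>2 j"
          using p pos1 by (simp add: field_simps)
        then show ?thesis using pos1 by linarith
      qed
      \<comment> \<open>The corner j = 0 is kept apart: there \<open>1 - tail\<close> is 0, and the
        first two waves cancel exactly.\<close>
      then have "(wave q \<theta>1 0 j - wave q \<theta>3 0 j - mgf q \<theta>1 i / mgf q \<theta>2 i * wave q \<theta>2 0 j)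
          \<le> (if j = 0 then 0 else mgf q \<theta>1 i)"
        using p pos1 by (auto simp: wave_def mgf_def[of q _ 0])
      then show ?thesis using pos1 by (cases j) (auto simp: divide_le_eq)
    qed
  qed (use q in auto)
qed

end

section \<open>Reduction of the exploration to the recursion\<close>

text \<open>One greedy step seen through the unexplored set alone, which evolves autonomously once
  the edges are fixed and determines the stopping time.\<close>

definition thin :: "nat set set \<Rightarrow> nat set \<Rightarrow> nat set pmf" where
  "thin E S = (if S = {} then return_pmf {}
     else map_pmf (\<lambda>v. S - insert v {w \<in> S. {v, w} \<in> E}) (pmf_of_set S))"

primrec rest :: "nat set set \<Rightarrow> nat \<Rightarrow> nat set \<Rightarrow> nat set pmf" where
  "rest E 0 S = return_pmf S"
| "rest E (Suc k) S = bind_pmf (thin E S) (rest E k)"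

text \<open>\<open>greedy_path\<close> appends steps at the end, while deferred decisions peel off
  the first step; this identity mediates between the two.\<close>

lemma rest_Suc_end: "rest E (Suc k) S = bind_pmf (rest E k S) (thin E)"
proof (induction k arbitrary: S)
  case 0
  have "rest E 0 = return_pmf" by (rule ext) simp
  then show ?case by (simp add: bind_return_pmf bind_return_pmf')
next
  case (Suc k)
  have "rest E (Suc (Suc k)) S = bind_pmf (thin E S) (rest E (Suc k))"
    by simp
  also have "\<dots> = bind_pmf (thin E S) (\<lambda>S'. bind_pmf (rest E k S') (thin E))"
    by (intro bind_pmf_cong refl) (rule Suc.IH)
  finally show ?case
    by (simp add: bind_assoc_pmf)
qed

lemma rest_empty [simp]: "rest E k {} = return_pmf {}"
  by (induction k) (simp_all add: thin_def bind_return_pmf)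

lemma unexplored_greedy_step:
  "map_pmf (unexplored N) (greedy_step N E s) = thin E (unexplored N s)"
  by (auto simp: greedy_step_def thin_def pmf.map_comp o_def unexplored_def explored_def
      intro!: map_pmf_cong)

lemma unexplored_greedy_path:
  "map_pmf (\<lambda>ss. unexplored N (last ss)) (greedy_path N E k) = rest E k {..<N}"
proof (induction k)
  case 0
  show ?case by (simp add: unexplored_def explored_def)
next
  case (Suc k)
  have "map_pmf (\<lambda>ss. unexplored N (last ss)) (greedy_path N E (Suc k))
      = bind_pmf (greedy_path N E k) (\<lambda>ss. map_pmf (unexplored N) (greedy_step N E (last ss)))"
    by (simp add: map_bind_pmf pmf.map_comp o_def)
  also have "\<dots> = bind_pmf (map_pmf (\<lambda>ss. unexplored N (last ss)) (greedy_path N E k)) (thin E)"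
    by (simp add: unexplored_greedy_step bind_map_pmf)
  finally show ?case
    unfolding Suc.IH by (simp only: rest_Suc_end)
qed

lemma length_greedy_path: "ss \<in> set_pmf (greedy_path N E k) \<Longrightarrow> length ss = Suc k"
  by (induction k arbitrary: ss) auto

lemma nth_greedy_path:
  assumes "k \<le> n"
  shows "map_pmf (\<lambda>ss. ss ! k) (greedy_path N E n) = map_pmf last (greedy_path N E k)"
  using assms
proof (induction n)
  case 0
  then show ?case by simp
next
  case (Suc n)
  show ?case
  proof (cases "k = Suc n")
    case True
    show ?thesis
      unfolding True
    proof (intro map_pmf_cong refl)
      fix ss assume "ss \<in> set_pmf (greedy_path N E (Suc n))"
      then have len: "length ss = Suc (Suc n)" by (rule length_greedy_path)
      then have "ss \<noteq> []" by auto
      with len show "ss ! Suc n = last ss" by (simp add: last_conv_nth)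
    qed
  next
    case False
    then have k: "k \<le> n" using Suc.prems by simp
    have "map_pmf (\<lambda>ss. ss ! k) (greedy_path N E (Suc n))
        = bind_pmf (greedy_path N E n) (\<lambda>ss. map_pmf (\<lambda>s. (ss @ [s]) ! k) (greedy_step N E (last ss)))"
      by (simp add: map_bind_pmf pmf.map_comp o_def)
    also have "\<dots> = bind_pmf (greedy_path N E n) (\<lambda>ss. map_pmf (\<lambda>s. ss ! k) (greedy_step N E (last ss)))"
      using k by (intro bind_pmf_cong map_pmf_cong refl) (auto dest!: length_greedy_path simp: nth_append)
    also have "\<dots> = map_pmf (\<lambda>ss. ss ! k) (greedy_path N E n)"
      by (simp add: map_pmf_const) (simp add: map_pmf_def)
    finally show ?thesis using Suc.IH[OF k] by simp
  qed
qed

text \<open>The cardinality bound forces termination by step N; the nesting of the unexplored sets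
  ensures that a finished exploration stays finished.\<close>

lemma greedy_path_shrinks:
  assumes "ss \<in> set_pmf (greedy_path N E n)"
  shows "\<forall>i\<le>n. explored (ss ! i) \<subseteq> {..<N} \<and> card (unexplored N (ss ! i)) \<le> N - i
      \<and> (\<forall>j\<le>i. unexplored N (ss ! i) \<subseteq> unexplored N (ss ! j))"
  using assms
proof (induction n arbitrary: ss)
  case 0
  then show ?case by (auto simp: explored_def unexplored_def)
next
  case (Suc n)
  then obtain ts s where ts: "ts \<in> set_pmf (greedy_path N E n)"
    and s: "s \<in> set_pmf (greedy_step N E (last ts))" and ss: "ss = ts @ [s]"
    by auto
  have len: "length ts = Suc n" by (rule length_greedy_path[OF ts])
  then have lst: "last ts = ts ! n" by (subst last_conv_nth) auto
  note IH = Suc.IH[OF ts]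
  have fin: "finite (unexplored N x)" for x by (simp add: unexplored_def)
  have step: "explored s \<subseteq> {..<N} \<and> unexplored N s \<subseteq> unexplored N (ts ! n)
      \<and> card (unexplored N s) \<le> card (unexplored N (ts ! n)) - 1"
  proof (cases "unexplored N (ts ! n) = {}")
    case True
    then show ?thesis using s lst IH by (auto simp: greedy_step_def)
  next
    case False
    then obtain v where v: "v \<in> unexplored N (ts ! n)"
      and s': "s = (insert v (fst (ts ! n)), snd (ts ! n) \<union> {w \<in> unexplored N (ts ! n). {v, w} \<in> E})"
      using s lst fin by (auto simp: greedy_step_def)
    have sub: "unexplored N s \<subseteq> unexplored N (ts ! n) - {v}"
      by (auto simp: s' unexplored_def explored_def)
    have "card (unexplored N s) \<le> card (unexplored N (ts ! n) - {v})"
      by (rule card_mono[OF _ sub]) (simp add: fin)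
    moreover have "explored s \<subseteq> {..<N}"
      using IH v by (auto simp: s' explored_def unexplored_def)
    ultimately show ?thesis using sub v fin by (auto simp: card_Diff_singleton)
  qed
  have old: "ss ! i = ts ! i" if "i \<le> n" for i
    using that len by (simp add: ss nth_append)
  have new: "ss ! Suc n = s"
    using len by (simp add: ss nth_append)
  have "card (unexplored N (ts ! n)) \<le> N - n" using IH by simp
  with step have "card (unexplored N s) \<le> N - Suc n" by linarith
  moreover have "unexplored N s \<subseteq> unexplored N (ts ! j)" if "j \<le> n" for j
    using step IH that by blast
  ultimately show ?case
    using step IH by (simp add: le_Suc_eq all_conj_distrib old new)
qed

lemma stop_time_greedy_path:
  assumes "ss \<in> set_pmf (greedy_path N E N)" and "k \<le> N"
  shows "Suc k \<le> stop_time N ss \<longleftrightarrow> unexplored N (ss ! k) \<noteq> {}"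
proof -
  note shrinks = greedy_path_shrinks[OF assms(1), rule_format]
  have full: "num_explored ss i = N \<longleftrightarrow> unexplored N (ss ! i) = {}" if "i \<le> N" for i
  proof -
    have sub: "explored (ss ! i) \<subseteq> {..<N}" using shrinks[OF that] by simp
    have "card (explored (ss ! i)) = N \<longleftrightarrow> explored (ss ! i) = {..<N}"
      using card_subset_eq[OF finite_lessThan sub] by (metis card_lessThan)
    also have "\<dots> \<longleftrightarrow> unexplored N (ss ! i) = {}"
      using sub by (auto simp: unexplored_def)
    finally show ?thesis by (simp add: num_explored_def)
  qed
  \<comment> \<open>Index N witnesses that the \<open>LEAST\<close> in \<open>stop_time\<close> is
    taken over a nonempty set and stays within the list.\<close>
  have "card (unexplored N (ss ! N)) = 0" using shrinks[of N] by simp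
  then have "unexplored N (ss ! N) = {}" by (simp add: unexplored_def)
  then have fN: "num_explored ss N = N" using full by simp
  have stop: "num_explored ss (stop_time N ss) = N" and le: "stop_time N ss \<le> N"
    unfolding stop_time_def by (rule LeastI[of "\<lambda>k. num_explored ss k = N", OF fN]) (rule Least_le[of "\<lambda>k. num_explored ss k = N", OF fN])
  show ?thesis
  proof
    assume "Suc k \<le> stop_time N ss"
    then have "num_explored ss k \<noteq> N"
      unfolding stop_time_def using not_less_Least[of k "\<lambda>k. num_explored ss k = N"] by simp
    then show "unexplored N (ss ! k) \<noteq> {}" using full assms(2) by simp
  next
    assume ne: "unexplored N (ss ! k) \<noteq> {}"
    show "Suc k \<le> stop_time N ss"
    proof (rule ccontr)
      assume "\<not> Suc k \<le> stop_time N ss"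
      then have "unexplored N (ss ! k) \<subseteq> unexplored N (ss ! stop_time N ss)"
        using shrinks[of k] assms(2) by auto
      then show False using ne full[OF le] stop by auto
    qed
  qed
qed

lemma prob_bind_pmf_cong:
  assumes "\<And>x. x \<in> set_pmf M \<Longrightarrow> measure_pmf.prob (f x) A = measure_pmf.prob (g x) B"
  shows "measure_pmf.prob (bind_pmf M f) A = measure_pmf.prob (bind_pmf M g) B"
proof -
  have "(\<integral>\<^sup>+x. emeasure (f x) A \<partial>measure_pmf M) = (\<integral>\<^sup>+x. emeasure (g x) B \<partial>measure_pmf M)"
    by (intro nn_integral_cong_AE)
      (simp add: AE_measure_pmf_iff measure_pmf.emeasure_eq_measure assms)
  then show ?thesis by (simp add: measure_def)
qed

lemma prob_stop_time:
  assumes "k \<le> N"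
  shows "measure_pmf.prob (greedy_exploration N p) {ss. Suc k \<le> stop_time N ss}
       = measure_pmf.prob (bind_pmf (erdos_renyi N p) (\<lambda>E. rest E k {..<N})) {S. S \<noteq> {}}"
  unfolding greedy_exploration_def
proof (rule prob_bind_pmf_cong)
  fix E
  have "measure_pmf.prob (greedy_path N E N) {ss. Suc k \<le> stop_time N ss}
      = measure_pmf.prob (greedy_path N E N) {ss. unexplored N (ss ! k) \<noteq> {}}"
    by (intro measure_pmf.finite_measure_eq_AE)
      (use stop_time_greedy_path[OF _ assms] in \<open>auto simp: AE_measure_pmf_iff\<close>)
  also have "\<dots> = measure_pmf.prob (map_pmf (unexplored N) (map_pmf (\<lambda>ss. ss ! k) (greedy_path N E N))) {S. S \<noteq> {}}"
    by (simp add: pmf.map_comp o_def vimage_def)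
  also have "map_pmf (unexplored N) (map_pmf (\<lambda>ss. ss ! k) (greedy_path N E N)) = rest E k {..<N}"
    by (simp add: nth_greedy_path[OF assms] pmf.map_comp o_def unexplored_greedy_path)
  finally show "measure_pmf.prob (greedy_path N E N) {ss. Suc k \<le> stop_time N ss}
      = measure_pmf.prob (rest E k {..<N}) {S. S \<noteq> {}}" .
qed

section \<open>Deferred decisions: from the random graph to a chain with binomial jumps\<close>

definition pairs :: "nat set \<Rightarrow> nat set set" where
  "pairs S = {e. e \<subseteq> S \<and> card e = 2}"

lemma finite_pairs: "finite S \<Longrightarrow> finite (pairs S)"
  by (simp add: pairs_def)

lemma doubleton_in_pairs: "v \<in> S \<Longrightarrow> w \<in> S \<Longrightarrow> w \<noteq> v \<Longrightarrow> {v, w} \<in> pairs S"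
  by (simp add: pairs_def)

lemma thin_cong:
  assumes "\<And>e. e \<in> pairs S \<Longrightarrow> e \<in> E \<longleftrightarrow> e \<in> E'" and "finite S"
  shows "thin E S = thin E' S"
proof (cases "S = {}")
  case False
  have "S - insert v {w \<in> S. {v, w} \<in> E} = S - insert v {w \<in> S. {v, w} \<in> E'}" if "v \<in> S" for v
    using assms(1)[OF doubleton_in_pairs[OF that]] by blast
  then have "map_pmf (\<lambda>v. S - insert v {w \<in> S. {v, w} \<in> E}) (pmf_of_set S)
      = map_pmf (\<lambda>v. S - insert v {w \<in> S. {v, w} \<in> E'}) (pmf_of_set S)"
    by (rule map_pmf_cong[OF refl]) (simp add: False assms(2))
  then show ?thesis by (simp add: thin_def)
qed (simp add: thin_def)

lemma set_pmf_thin: "finite S \<Longrightarrow> S' \<in> set_pmf (thin E S) \<Longrightarrow> S' \<subseteq> S"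
  by (auto simp: thin_def split: if_splits)

text \<open>A run started from S queries only edges inside S, so all other edges may be changed
  freely, in particular those at vertices already explored.\<close>

lemma rest_cong:
  assumes "\<And>e. e \<in> pairs S \<Longrightarrow> e \<in> E \<longleftrightarrow> e \<in> E'" and "finite S"
  shows "rest E k S = rest E' k S"
  using assms
proof (induction k arbitrary: S)
  case 0
  show ?case by simp
next
  case (Suc k)
  have "rest E k S' = rest E' k S'" if "S' \<in> set_pmf (thin E' S)" for S'
  proof (rule Suc.IH)
    have "S' \<subseteq> S" using set_pmf_thin[OF Suc.prems(2) that] .
    then show "finite S'" and "\<And>e. e \<in> pairs S' \<Longrightarrow> e \<in> E \<longleftrightarrow> e \<in> E'"
      using Suc.prems by (auto simp: pairs_def intro: finite_subset)
  qed
  then show ?case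
    using thin_cong[of S E E'] Suc.prems by (auto intro!: bind_pmf_cong)
qed

text \<open>The law of N - Z for the Markov chain Z of the problem, composed from the first step
  on.\<close>

primrec num_left :: "real \<Rightarrow> nat \<Rightarrow> nat \<Rightarrow> nat pmf" where
  "num_left p 0 n = return_pmf n"
| "num_left p (Suc k) n = (if n = 0 then return_pmf 0
     else bind_pmf (binomial_pmf (n - 1) p) (\<lambda>j. num_left p k (n - 1 - j)))"

text \<open>Deferred decisions: the edges at the vertex chosen first are independent of the others.\<close>

lemma card_rest:
  assumes "p \<in> {0..1}" and "finite S" and "finite Q" and "pairs S \<subseteq> Q"
  shows "bind_pmf (Pi_pmf Q False (\<lambda>_. bernoulli_pmf p)) (\<lambda>f. map_pmf card (rest (Collect f) k S))
       = num_left p k (card S)"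
  using assms(2-)
proof (induction k arbitrary: S Q)
  case 0
  show ?case by simp
next
  case (Suc k)
  let ?B = "\<lambda>A. Pi_pmf A False (\<lambda>_. bernoulli_pmf p)"
  show ?case
  proof (cases "S = {}")
    case True
    then show ?thesis by (simp del: rest.simps)
  next
    case False
    have "card S \<noteq> 0" using False Suc.prems by simp
    \<comment> \<open>With the first vertex v fixed, the edges from v into S decide who is blocked,
      and the remaining run uses none of them. Any \<open>Q\<close> containing
      \<open>pairs S\<close> is allowed so that the induction hypothesis applies to
      \<open>Q - A\<close>.\<close>
    have star: "bind_pmf (?B Q) (\<lambda>f. map_pmf card (rest (Collect f) k (S - insert v {w \<in> S. f {v, w}})))
        = num_left p (Suc k) (card S)" if v: "v \<in> S" for v
    proof -
      define A where "A = (\<lambda>w. {v, w}) ` (S - {v})"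
      have inj: "inj_on (\<lambda>w. {v, w}) (S - {v})"
        by (auto simp: inj_on_def doubleton_eq_iff)
      have A: "finite A" "card A = card S - 1"
        using Suc.prems v by (simp_all add: A_def card_image[OF inj])
      have AQ: "A \<subseteq> Q"
        using doubleton_in_pairs[OF v] Suc.prems(3) by (auto simp: A_def)
      define S' where "S' f = S - insert v {w \<in> S - {v}. f {v, w}}" for f
      let ?h = "\<lambda>f g x. if x \<in> A then f x else g x"
      have "bind_pmf (?B Q) (\<lambda>f. map_pmf card (rest (Collect f) k (S - insert v {w \<in> S. f {v, w}})))
        = bind_pmf (?B (A \<union> (Q - A))) (\<lambda>f. map_pmf card (rest (Collect f) k (S - insert v {w \<in> S. f {v, w}})))"
        using AQ by (simp add: Un_absorb1)
      also have "\<dots> = bind_pmf (?B A) (\<lambda>f. bind_pmf (?B (Q - A)) (\<lambda>g.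
          map_pmf card (rest (Collect (?h f g)) k (S - insert v {w \<in> S. ?h f g {v, w}}))))"
        using A Suc.prems
        by (subst Pi_pmf_union) (auto simp: bind_map_pmf pair_pmf_def bind_assoc_pmf bind_return_pmf)
      also have "\<dots> = bind_pmf (?B A) (\<lambda>f. bind_pmf (?B (Q - A)) (\<lambda>g.
          map_pmf card (rest (Collect g) k (S' f))))"
      proof (intro bind_pmf_cong refl)
        fix f g
        have "S - insert v {w \<in> S. ?h f g {v, w}} = S' f"
          by (auto simp: S'_def A_def)
        moreover have "rest (Collect (?h f g)) k (S' f) = rest (Collect g) k (S' f)"
          by (rule rest_cong) (use Suc.prems in \<open>auto simp: S'_def A_def pairs_def\<close>)
        ultimately show "map_pmf card (rest (Collect (?h f g)) k (S - insert v {w \<in> S. ?h f g {v, w}}))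
            = map_pmf card (rest (Collect g) k (S' f))" by simp
      qed
      also have "\<dots> = bind_pmf (?B A) (\<lambda>f. num_left p k (card (S' f)))"
        using Suc.prems
        by (intro bind_pmf_cong refl Suc.IH) (auto simp: S'_def A_def pairs_def)
      also have "\<dots> = bind_pmf (?B A) (\<lambda>f. num_left p k (card S - 1 - card {x \<in> A. f x}))"
      proof (intro bind_pmf_cong refl)
        fix f
        let ?W = "{w \<in> S - {v}. f {v, w}}"
        have "{x \<in> A. f x} = (\<lambda>w. {v, w}) ` ?W" by (auto simp: A_def)
        then have "card {x \<in> A. f x} = card ?W"
          using card_image[OF inj_on_subset[OF inj, of ?W]] by auto
        moreover have "S' f = (S - {v}) - ?W" by (auto simp: S'_def)
        then have "card (S' f) = card (S - {v}) - card ?W"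
          using Suc.prems by (metis (no_types, lifting) card_Diff_subset finite_Diff finite_subset mem_Collect_eq subsetI)
        ultimately show "num_left p k (card (S' f)) = num_left p k (card S - 1 - card {x \<in> A. f x})"
          using v by simp
      qed
      also have "\<dots> = bind_pmf (binomial_pmf (card S - 1) p) (\<lambda>j. num_left p k (card S - 1 - j))"
        unfolding binomial_pmf_altdef'[OF A assms(1), of False] bind_map_pmf ..
      finally show ?thesis
        using \<open>card S \<noteq> 0\<close> by simp
    qed
    have "bind_pmf (?B Q) (\<lambda>f. map_pmf card (rest (Collect f) (Suc k) S))
        = bind_pmf (?B Q) (\<lambda>f. bind_pmf (pmf_of_set S) (\<lambda>v.
            map_pmf card (rest (Collect f) k (S - insert v {w \<in> S. f {v, w}}))))"
      using False by (simp add: thin_def map_bind_pmf bind_map_pmf)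
    \<comment> \<open>The choice of v does not depend on the edges, so it may be drawn before the
      graph.\<close>
    also have "\<dots> = bind_pmf (pmf_of_set S) (\<lambda>v. bind_pmf (?B Q) (\<lambda>f.
            map_pmf card (rest (Collect f) k (S - insert v {w \<in> S. f {v, w}}))))"
      by (rule bind_commute_pmf)
    also have "\<dots> = bind_pmf (pmf_of_set S) (\<lambda>v. num_left p (Suc k) (card S))"
      by (intro bind_pmf_cong refl star) (use False Suc.prems in auto)
    finally show ?thesis by (simp del: num_left.simps)
  qed
qed

definition alive :: "real \<Rightarrow> nat \<Rightarrow> nat \<Rightarrow> real" where
  "alive p k n = measure_pmf.prob (num_left p k n) {0<..}"

lemma alive_0: "alive p 0 n = (if n = 0 then 0 else 1)"
  by (simp add: alive_def)

lemma alive_zero: "alive p k 0 = 0"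
  by (induction k) (simp_all add: alive_def)

lemma prob_stop_time_alive:
  assumes "k \<le> N" "p \<in> {0..1}"
  shows "measure_pmf.prob (greedy_exploration N p) {ss. Suc k \<le> stop_time N ss} = alive p k N"
proof -
  let ?M = "bind_pmf (erdos_renyi N p) (\<lambda>E. rest E k {..<N})"
  have M: "map_pmf card ?M = num_left p k N"
    using card_rest[OF assms(2), of "{..<N}" "pairs {..<N}" k]
    by (simp add: finite_pairs erdos_renyi_def bind_map_pmf map_bind_pmf) (simp add: pairs_def)
  have fin: "finite S" if "S \<in> set_pmf ?M" for S
  proof -
    have "S \<subseteq> {..<N}" if "S \<in> set_pmf (rest E k S')" "S' \<subseteq> {..<N}" for E S'
      using that by (induction k arbitrary: S')
        (auto dest!: set_pmf_thin[rotated] intro: finite_subset)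
    with that show ?thesis by (auto intro: finite_subset)
  qed
  have "measure_pmf.prob ?M {S. S \<noteq> {}} = measure_pmf.prob ?M (card -` {0<..})"
    by (intro measure_pmf.finite_measure_eq_AE)
      (use fin in \<open>auto simp: AE_measure_pmf_iff card_gt_0_iff\<close>)
  also have "\<dots> = alive p k N"
    by (simp add: alive_def flip: M)
  finally show ?thesis
    by (simp add: prob_stop_time[OF assms(1)])
qed

section \<open>Recursion in the number of vertices\<close>

definition binom_exp :: "real \<Rightarrow> nat \<Rightarrow> (nat \<Rightarrow> real) \<Rightarrow> real" where
  "binom_exp p n g = measure_pmf.expectation (binomial_pmf n p) (\<lambda>j. g (n - j))"

lemma prob_bind_pmf:
  "measure_pmf.prob (bind_pmf M f) A = measure_pmf.expectation M (\<lambda>x. measure_pmf.prob (f x) A)"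
proof -
  have "ennreal (measure_pmf.prob (bind_pmf M f) A) = (\<integral>\<^sup>+x. ennreal (measure_pmf.prob (f x) A) \<partial>measure_pmf M)"
    by (simp flip: measure_pmf.emeasure_eq_measure add: emeasure_bind_pmf)
  also have "\<dots> = ennreal (measure_pmf.expectation M (\<lambda>x. measure_pmf.prob (f x) A))"
    by (rule nn_integral_eq_integral)
      (auto intro!: measure_pmf.integrable_const_bound[where B = 1])
  finally show ?thesis
    by (simp add: Bochner_Integration.integral_nonneg)
qed

lemma alive_Suc: "alive p (Suc k) (Suc n) = binom_exp p n (alive p k)"
  by (simp add: alive_def binom_exp_def prob_bind_pmf)

context
  fixes p :: real assumes p: "p \<in> {0..1}"
begin

lemma integrable_binomial: "integrable (measure_pmf (binomial_pmf n p)) (f :: nat \<Rightarrow> real)"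
  by (rule integrable_measure_pmf_finite) (rule finite_set_pmf_binomial_pmf[OF p])

lemma binom_exp_linear:
  "binom_exp p n (\<lambda>j. a * g j + b * h j) = a * binom_exp p n g + b * binom_exp p n h"
  by (simp add: binom_exp_def integrable_binomial)

lemma binom_exp_const: "binom_exp p n (\<lambda>j. a) = a"
  by (simp add: binom_exp_def)

lemma binom_exp_Suc:
  "binom_exp p (Suc n) g = p * binom_exp p n g + (1 - p) * binom_exp p n (\<lambda>j. g (Suc j))"
proof -
  let ?f = "\<lambda>b k. g (Suc n - ((if b then 1 else 0) + k))"
  have "finite (set_pmf (map_pmf h (binomial_pmf n p)))" for h :: "nat \<Rightarrow> nat"
    by (simp add: finite_set_pmf_binomial_pmf[OF p])
  then have "binom_exp p (Suc n) g = p * measure_pmf.expectation (binomial_pmf n p) (?f True)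
      + (1 - p) * measure_pmf.expectation (binomial_pmf n p) (?f False)"
    unfolding binom_exp_def binomial_pmf_Suc[OF p] map_pmf_def[symmetric]
    by (subst pmf_expectation_bind[where A = UNIV]) (use p in \<open>auto simp: UNIV_bool\<close>)
  \<comment> \<open>\<open>Suc n - j = Suc (n - j)\<close> fails for truncated subtraction beyond n,
    so the support of the binomial law is used here.\<close>
  also have "measure_pmf.expectation (binomial_pmf n p) (?f False)
      = measure_pmf.expectation (binomial_pmf n p) (\<lambda>j. g (Suc (n - j)))"
    by (rule Bochner_Integration.integral_cong_AE)
      (use p in \<open>auto simp: AE_measure_pmf_iff set_pmf_binomial_eq Suc_diff_le split: if_splits\<close>)
  finally show ?thesis by (simp add: binom_exp_def)
qed

end

text \<open>The factor (1 - p)^k is the chance that an extra vertex is adjacent to none of k active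
  ones. Induction on k: in the first step \<open>binom_exp_Suc\<close> separates one vertex, which
  is either blocked at once or survives into the induction hypothesis. The value 1 for k = 0 matches
  \<open>tail q n 0 = 1\<close>.\<close>

lemma alive_Suc_right:
  assumes p: "p \<in> {0..1}"
  shows "alive p k (Suc n) = (1 - (1 - p) ^ k) * alive p k n
    + (1 - p) ^ k * (if k = 0 then 1 else alive p (k - 1) n)"
proof (induction k arbitrary: n)
  case 0
  show ?case by (simp add: alive_0)
next
  case (Suc k)
  show ?case
  proof (cases n)
    case 0
    then show ?thesis by (simp add: alive_zero alive_Suc binom_exp_def)
  next
    case (Suc m)
    have "alive p (Suc k) (Suc n) = p * alive p (Suc k) n + (1 - p) * binom_exp p m (\<lambda>j. alive p k (Suc j))"
      by (simp add: Suc alive_Suc binom_exp_Suc[OF p])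
    also have "binom_exp p m (\<lambda>j. alive p k (Suc j)) = (1 - (1 - p) ^ k) * alive p (Suc k) n
        + (1 - p) ^ k * alive p k n"
      by (subst Suc.IH) (cases k, simp_all add: Suc alive_Suc alive_0 binom_exp_const[OF p] binom_exp_linear[OF p])
    finally show ?thesis by (simp add: algebra_simps)
  qed
qed

lemma alive_eq_tail:
  assumes p: "p \<in> {0..1}"
  shows "alive p k n = tail (1 - p) n (Suc k)"
proof (induction n arbitrary: k)
  case 0
  show ?case by (simp add: alive_zero)
next
  case (Suc n)
  show ?case
    by (subst alive_Suc_right[OF p]) (cases k, simp_all add: Suc)
qed

lemma prob_stop_time_eq_tail:
  assumes "k \<le> N" "p \<in> {0..1}"
  shows "measure_pmf.prob (greedy_exploration N p) {ss. k \<le> stop_time N ss} = tail (1 - p) N k"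
proof (cases k)
  case (Suc j)
  then show ?thesis
    using prob_stop_time_alive[of j N p] alive_eq_tail[OF assms(2), of j N] assms by simp
qed simp

section \<open>The limiting logarithmic moment generating function\<close>

text \<open>
  The momentum of the Hamiltonian system satisfies \<open>exp (- \<alpha> t) = denom \<alpha>\<^sub>0 (c * t)\<close>; the same
  expression is the continuum limit of \<open>mgf_denom\<close>.
\<close>

definition denom :: "real \<Rightarrow> real \<Rightarrow> real" where
  "denom \<theta> s = 1 + (exp (- \<theta>) - 1) * exp s"

text \<open>Up to sign and a factor 1/c, the limit of \<open>ln mgf / N\<close>; measuring s as c
  times the time keeps c out of the definition.\<close>

definition Phi :: "real \<Rightarrow> real \<Rightarrow> real" where
  "Phi \<theta> x = integral {0..x} (\<lambda>s. ln (denom \<theta> s))"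

lemma denom_0: "denom \<theta> 0 = exp (- \<theta>)"
  by (simp add: denom_def)

lemma denom_pos:
  assumes "0 < denom \<theta> x" "0 \<le> s" "s \<le> x"
  shows "0 < denom \<theta> s"
proof (cases "0 \<le> exp (- \<theta>) - 1")
  case True
  then show ?thesis by (simp add: denom_def add_pos_nonneg)
next
  case False
  then have "(exp (- \<theta>) - 1) * exp x \<le> (exp (- \<theta>) - 1) * exp s"
    using assms by (intro mult_left_mono_neg) auto
  then show ?thesis using assms by (simp add: denom_def)
qed

lemma denom_antimono: "\<theta> \<le> \<theta>' \<Longrightarrow> denom \<theta>' s \<le> denom \<theta> s"
  by (simp add: denom_def mult_right_mono)

lemma continuous_on_denom [continuous_intros]:
  "continuous_on A f \<Longrightarrow> continuous_on A g \<Longrightarrow> continuous_on A (\<lambda>x. denom (f x) (g x))"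
  unfolding denom_def by (intro continuous_intros)

lemma denom_pos_eventually:
  assumes "0 < denom \<theta> x"
  shows "\<forall>\<^sub>F \<eta> in at 0. 0 < denom (\<theta> + \<eta>) x" "\<forall>\<^sub>F \<eta> in at 0. 0 < denom \<theta> (x + \<eta>)"
proof -
  have "((\<lambda>\<eta>. denom (\<theta> + \<eta>) x) \<longlongrightarrow> denom (\<theta> + 0) x) (at 0)"
    "((\<lambda>\<eta>. denom \<theta> (x + \<eta>)) \<longlongrightarrow> denom \<theta> (x + 0)) (at 0)"
    unfolding denom_def by (intro tendsto_intros)+
  then show "\<forall>\<^sub>F \<eta> in at 0. 0 < denom (\<theta> + \<eta>) x" "\<forall>\<^sub>F \<eta> in at 0. 0 < denom \<theta> (x + \<eta>)"
    using assms by (auto dest: order_tendstoD(1))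
qed

lemma denom_pos_larger_theta:
  assumes "0 < denom \<theta> x"
  obtains \<theta>' where "\<theta> < \<theta>'" "0 < denom \<theta>' x"
proof -
  have "\<forall>\<^sub>F \<eta> in at_right 0. 0 < denom (\<theta> + \<eta>) x"
    using denom_pos_eventually(1)[OF assms] by (simp add: eventually_at_split)
  with eventually_at_right_less[of "0 :: real"]
  have "\<forall>\<^sub>F \<eta> in at_right 0. 0 < \<eta> \<and> 0 < denom (\<theta> + \<eta>) x"
    by eventually_elim simp
  then obtain \<eta> where "0 < \<eta>" "0 < denom (\<theta> + \<eta>) x"
    using eventually_happens'[OF trivial_limit_at_right_real] by blast
  then show thesis using that[of "\<theta> + \<eta>"] by simp
qed

lemma denom_pos_larger_x:
  assumes "0 < denom \<theta> x"
  obtains y where "x < y" "0 < denom \<theta> y"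
proof -
  have "\<forall>\<^sub>F \<eta> in at_right 0. 0 < denom \<theta> (x + \<eta>)"
    using denom_pos_eventually(2)[OF assms] by (simp add: eventually_at_split)
  with eventually_at_right_less[of "0 :: real"]
  have "\<forall>\<^sub>F \<eta> in at_right 0. 0 < \<eta> \<and> 0 < denom \<theta> (x + \<eta>)"
    by eventually_elim simp
  then obtain \<eta> where "0 < \<eta>" "0 < denom \<theta> (x + \<eta>)"
    using eventually_happens'[OF trivial_limit_at_right_real] by blast
  then show thesis using that[of "x + \<eta>"] by simp
qed

lemma continuous_on_ln_denom:
  assumes "0 < denom \<theta> x"
  shows "continuous_on {0..x} (\<lambda>s. ln (denom \<theta> s))"
proof (intro continuous_intros ballI)
  fix s assume "s \<in> {0..x}"
  then show "denom \<theta> s \<noteq> 0" using denom_pos[OF assms, of s] by auto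
qed

lemma Phi_0 [simp]: "Phi \<theta> 0 = 0"
  by (simp add: Phi_def)

lemma Phi_derivative_x:
  assumes "0 < denom \<theta> x" "s \<in> {0..x}"
  shows "(Phi \<theta> has_real_derivative ln (denom \<theta> s)) (at s within {0..x})"
  unfolding Phi_def[abs_def]
  by (rule integral_has_real_derivative[OF continuous_on_ln_denom[OF assms(1)] assms(2)])

text \<open>The integrand is minus the \<theta>-derivative of \<open>ln (denom \<theta> s)\<close>:
  the mean of a geometric variable with success probability exp(-s), tilted by \<theta>. Since
  \<open>denom - 1\<close> is proportional to exp(s), it is also a multiple of a logarithmic
  derivative in s.\<close>

lemma integral_tilted_mean:
  assumes "0 < denom \<theta> x" "0 \<le> x" "\<theta> \<noteq> 0"
  shows "integral {0..x} (\<lambda>s. exp (- \<theta>) * exp s / denom \<theta> s) = (ln (denom \<theta> x) + \<theta>) / (1 - exp \<theta>)"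
proof -
  let ?b = "exp (- \<theta>) - 1"
  let ?F = "\<lambda>s. exp (- \<theta>) / ?b * ln (denom \<theta> s)"
  have b: "?b \<noteq> 0" using assms by simp
  have "((\<lambda>s. exp (- \<theta>) * exp s / denom \<theta> s) has_integral (?F x - ?F 0)) {0..x}"
  proof (rule fundamental_theorem_of_calculus[OF assms(2)])
    fix s assume "s \<in> {0..x}"
    then have "0 < denom \<theta> s" using denom_pos[OF assms(1), of s] by auto
    then have "(?F has_real_derivative exp (- \<theta>) * exp s / denom \<theta> s) (at s within {0..x})"
      unfolding denom_def using b by (auto intro!: derivative_eq_intros simp: divide_simps)
    then show "(?F has_vector_derivative exp (- \<theta>) * exp s / denom \<theta> s) (at s within {0..x})"
      by (simp add: has_real_derivative_iff_has_vector_derivative)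
  qed
  then have "integral {0..x} (\<lambda>s. exp (- \<theta>) * exp s / denom \<theta> s) = ?F x - ?F 0"
    by (rule integral_unique)
  also have "\<dots> = exp (- \<theta>) / ?b * (ln (denom \<theta> x) + \<theta>)"
    by (simp add: denom_0 distrib_left)
  also have "exp (- \<theta>) / ?b = 1 / (1 - exp \<theta>)"
    using assms(3) by (simp add: exp_minus field_simps)
  finally show ?thesis by simp
qed

lemma Phi_derivative_theta:
  assumes "0 < denom \<theta> x" "0 \<le> x" "\<theta> \<noteq> 0"
  shows "((\<lambda>\<theta>. Phi \<theta> x) has_real_derivative - ((ln (denom \<theta> x) + \<theta>) / (1 - exp \<theta>))) (at \<theta>)"
proof -
  \<comment> \<open>Room to the right makes \<theta> an interior point of
    \<open>{..\<theta>'}\<close>, and on this convex set \<open>denom\<close> stays positive because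
    it decreases in \<theta>.\<close>
  obtain \<theta>' where th': "\<theta> < \<theta>'" "0 < denom \<theta>' x"
    by (rule denom_pos_larger_theta[OF assms(1)])
  have pos: "0 < denom \<zeta> s" if "\<zeta> \<in> {..\<theta>'}" "s \<in> {0..x}" for \<zeta> s
  proof -
    have "0 < denom \<theta>' s" using th'(2) that by (auto intro: denom_pos[OF th'(2)])
    with denom_antimono[of \<zeta> \<theta>' s] that show ?thesis by auto
  qed
  have "((\<lambda>\<zeta>. integral (cbox 0 x) (\<lambda>s. ln (denom \<zeta> s))) has_field_derivative
      integral (cbox 0 x) (\<lambda>s. - (exp (- \<theta>) * exp s / denom \<theta> s))) (at \<theta> within {..\<theta>'})"
  proof (rule leibniz_rule_field_derivative)
    show "((\<lambda>\<zeta>. ln (denom \<zeta> s)) has_field_derivative - (exp (- \<zeta>) * exp s / denom \<zeta> s)) (at \<zeta> within {..\<theta>'})"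
      if "\<zeta> \<in> {..\<theta>'}" "s \<in> cbox 0 x" for \<zeta> s
      using pos[OF that(1)] that(2) unfolding denom_def
      by (auto intro!: derivative_eq_intros simp: divide_simps)
    show "(\<lambda>s. ln (denom \<zeta> s)) integrable_on cbox 0 x" if "\<zeta> \<in> {..\<theta>'}" for \<zeta>
      using continuous_on_ln_denom[of \<zeta> x] pos[OF that, of x] assms(2)
      by (intro integrable_continuous) auto
    have "continuous_on ({..\<theta>'} \<times> {0..x}) (\<lambda>y. - (exp (- fst y) * exp (snd y) / denom (fst y) (snd y)))"
      using pos by (intro continuous_intros) (auto simp: less_imp_neq[THEN not_sym])
    then show "continuous_on ({..\<theta>'} \<times> cbox 0 x) (\<lambda>(\<zeta>, s). - (exp (- \<zeta>) * exp s / denom \<zeta> s))"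
      by (simp add: split_beta)
  qed (use th' in auto)
  then have "((\<lambda>\<zeta>. Phi \<zeta> x) has_field_derivative
      - integral {0..x} (\<lambda>s. exp (- \<theta>) * exp s / denom \<theta> s)) (at \<theta> within {..\<theta>'})"
    by (simp add: Phi_def)
  moreover have "at \<theta> within {..\<theta>'} = at \<theta>"
    using th' by (intro at_within_interior) simp
  ultimately show ?thesis
    by (simp add: integral_tilted_mean[OF assms])
qed

section \<open>Riemann sums for the logarithm of the moment generating function\<close>

lemma riemann_sum_bound:
  fixes \<phi> \<Phi> :: "real \<Rightarrow> real"
  assumes der: "\<And>s. s \<in> {0..B} \<Longrightarrow> (\<Phi> has_real_derivative \<phi> s) (at s within {0..B})"
    and lip: "\<And>s r. s \<in> {0..B} \<Longrightarrow> r \<in> {0..B} \<Longrightarrow> \<bar>\<phi> s - \<phi> r\<bar> \<le> L * \<bar>s - r\<bar>"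
    and "0 \<le> h" "h * real k \<le> B"
  shows "\<bar>h * (\<Sum>j<k. \<phi> (h * real j)) - (\<Phi> (h * real k) - \<Phi> 0)\<bar> \<le> L * h\<^sup>2 * real k"
  using assms(4)
proof (induction k)
  case 0
  show ?case by simp
next
  case (Suc k)
  let ?x = "h * real k" and ?y = "h * real (Suc k)"
  have xy: "0 \<le> ?x" "?x \<le> ?y" "?y \<le> B" "?y - ?x = h"
    using Suc.prems assms(3) by (auto simp: algebra_simps)
  \<comment> \<open>By the mean value theorem the increment of \<Phi> over a cell is h \<phi>(z)
    with z in the cell, so the Lipschitz bound makes every cell cost at most L h^2.\<close>
  have step: "\<bar>h * \<phi> ?x - (\<Phi> ?y - \<Phi> ?x)\<bar> \<le> L * h\<^sup>2"
  proof (cases "h = 0")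
    case False
    then have "?x < ?y" using xy assms(3) by simp
    moreover have "(\<Phi> has_derivative (*) (\<phi> s)) (at s within {?x..?y})" if "?x \<le> s" "s \<le> ?y" for s
    proof -
      have "s \<in> {0..B}" using xy(1,3) that by (simp only: atLeastAtMost_iff) linarith
      moreover have "{?x..?y} \<subseteq> {0..B}" using xy(1,3) by (simp only: atLeastatMost_subset_iff) blast
      ultimately show ?thesis
        unfolding has_field_derivative_def[symmetric] by (intro DERIV_subset[OF der])
    qed
    ultimately obtain z where z: "z \<in> {?x<..<?y}" "\<Phi> ?y - \<Phi> ?x = \<phi> z * (?y - ?x)"
      using mvt_simple[of ?x ?y \<Phi> "\<lambda>s. (*) (\<phi> s)"] by auto
    have zz: "?x < z" "z < ?y" using z(1) by (simp_all only: greaterThanLessThan_iff)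
    have mem: "?x \<in> {0..B}" "?y \<in> {0..B}" "z \<in> {0..B}"
      unfolding atLeastAtMost_iff by (intro conjI; use zz xy(1-3) in linarith)+
    have "\<bar>h * \<phi> ?x - (\<Phi> ?y - \<Phi> ?x)\<bar> = h * \<bar>\<phi> ?x - \<phi> z\<bar>"
      unfolding z(2) xy(4) using assms(3) by (simp add: abs_mult flip: right_diff_distrib' mult.commute[of h])
    also have "\<dots> \<le> h * (L * \<bar>?x - z\<bar>)"
      by (intro mult_left_mono lip mem assms(3))
    also have "\<dots> \<le> h * (L * h)"
    proof (intro mult_left_mono)
      show "\<bar>?x - z\<bar> \<le> h" using zz xy(4) by linarith
      show "0 \<le> L" using lip[OF mem(1,2)] \<open>?x < ?y\<close>
        by (smt (verit) zero_le_mult_iff)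
    qed (rule assms(3))
    finally show ?thesis by (simp add: power2_eq_square algebra_simps)
  qed simp
  have "\<bar>h * (\<Sum>j<k. \<phi> (h * real j)) - (\<Phi> ?x - \<Phi> 0)\<bar> \<le> L * h\<^sup>2 * real k"
    using xy by (intro Suc.IH) linarith
  with step have "\<bar>(h * (\<Sum>j<k. \<phi> (h * real j)) - (\<Phi> ?x - \<Phi> 0)) + (h * \<phi> ?x - (\<Phi> ?y - \<Phi> ?x))\<bar>
      \<le> L * h\<^sup>2 * real k + L * h\<^sup>2"
    by linarith
  then show ?case by (simp add: algebra_simps)
qed

lemma ln_denom_lipschitz:
  assumes "0 < denom \<theta> x"
  obtains L where "\<And>s r. s \<in> {0..x} \<Longrightarrow> r \<in> {0..x} \<Longrightarrow> \<bar>ln (denom \<theta> s) - ln (denom \<theta> r)\<bar> \<le> L * \<bar>s - r\<bar>"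
proof -
  let ?f = "\<lambda>s. (exp (- \<theta>) - 1) * exp s / denom \<theta> s"
  have pos: "0 < denom \<theta> s" if "s \<in> {0..x}" for s
    using that denom_pos[OF assms, of s] by auto
  have "continuous_on {0..x} ?f"
    using pos by (intro continuous_intros ballI) (auto simp: less_imp_neq[THEN not_sym])
  then have "bounded (?f ` {0..x})"
    by (intro compact_imp_bounded compact_continuous_image) auto
  then obtain L where L: "\<And>s. s \<in> {0..x} \<Longrightarrow> norm (?f s) \<le> L"
    unfolding bounded_iff by blast
  have "\<bar>ln (denom \<theta> s) - ln (denom \<theta> r)\<bar> \<le> L * \<bar>s - r\<bar>" if "s \<in> {0..x}" "r \<in> {0..x}" for s r
    unfolding real_norm_def[symmetric]
  proof (rule field_differentiable_bound[OF _ _ L that(1) that(2)])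
    show "((\<lambda>s. ln (denom \<theta> s)) has_field_derivative ?f s) (at s within {0..x})" if "s \<in> {0..x}" for s
      using pos[OF that] unfolding denom_def
      by (auto intro!: derivative_eq_intros simp: divide_simps)
  qed auto
  then show thesis by (rule that)
qed

text \<open>The discrete factors are exact samples of \<open>denom\<close> on a grid of width -ln q,
  so the passage to the limit is purely a matter of Riemann sums.\<close>

lemma mgf_denom_eq_denom:
  assumes "0 < q"
  shows "mgf_denom q \<theta> j = denom \<theta> (- ln q * real j)"
proof -
  have "exp (- ln q * real j) = 1 / q ^ j"
    using assms exp_of_nat_mult[of j "ln q"] by (simp add: exp_minus field_simps)
  then show ?thesis by (simp add: mgf_denom_def denom_def)
qed

lemma ln_mgf:
  assumes "\<And>j. j < k \<Longrightarrow> 0 < mgf_denom q \<theta> j"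
  shows "ln (mgf q \<theta> k) = - (\<Sum>j<k. ln (mgf_denom q \<theta> j))"
proof -
  have ne: "mgf_denom q \<theta> j \<noteq> 0" if "j < k" for j
    using assms[OF that] by simp
  have "ln (mgf q \<theta> k) = (\<Sum>j<k. ln (1 / mgf_denom q \<theta> j))"
    unfolding mgf_def using ne by (intro ln_prod) auto
  also have "\<dots> = (\<Sum>j<k. - ln (mgf_denom q \<theta> j))"
    using assms by (intro sum.cong) (auto simp: ln_div)
  finally show ?thesis by (simp add: sum_negf)
qed

context
  fixes c t :: real and k :: "nat \<Rightarrow> nat"
  assumes c: "0 < c" and t: "0 \<le> t" and k: "(\<lambda>N. real (k N) / real N) \<longlonglongrightarrow> t"
begin

text \<open>The grid width for q = 1 - c/N; it equals c/N only asymptotically.\<close>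

definition mesh :: "nat \<Rightarrow> real" where
  "mesh N = - ln (1 - c / real N)"

lemma mesh_scaled: "(\<lambda>N. real N * mesh N) \<longlonglongrightarrow> c"
  unfolding mesh_def using c by real_asymp

lemma eventually_large: "\<forall>\<^sub>F N in sequentially. c < real N \<and> 0 < mesh N"
proof -
  have "\<forall>\<^sub>F N in sequentially. c < real N" by real_asymp
  then show ?thesis
    by eventually_elim (use c in \<open>auto simp: mesh_def field_simps intro!: ln_less_zero\<close>)
qed

lemma mesh_k: "(\<lambda>N. mesh N * real (k N)) \<longlonglongrightarrow> c * t"
proof -
  have "(\<lambda>N. (real N * mesh N) * (real (k N) / real N)) \<longlonglongrightarrow> c * t"
    by (intro tendsto_mult mesh_scaled k)
  then show ?thesis
    by (rule Lim_transform_eventually)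
      (use eventually_gt_at_top[of 0] in \<open>eventually_elim, simp\<close>)
qed

lemma
  assumes pos: "0 < denom \<theta> (c * t)"
  shows eventually_mgf_denom_pos: "\<forall>\<^sub>F N in sequentially. \<forall>j<k N. 0 < mgf_denom (1 - c / real N) \<theta> j"
    and ln_mgf_limit: "(\<lambda>N. ln (mgf (1 - c / real N) \<theta> (k N)) / real N) \<longlonglongrightarrow> - (Phi \<theta> (c * t) / c)"
proof -
  \<comment> \<open>The last grid point tends to c t but may exceed it; B leaves room on the
    right.\<close>
  obtain B where B: "c * t < B" "0 < denom \<theta> B"
    by (rule denom_pos_larger_x[OF pos])
  have ct: "0 \<le> c * t" using c t by simp
  let ?\<phi> = "\<lambda>s. ln (denom \<theta> s)"
  obtain L where lip: "\<And>s r. s \<in> {0..B} \<Longrightarrow> r \<in> {0..B} \<Longrightarrow> \<bar>?\<phi> s - ?\<phi> r\<bar> \<le> L * \<bar>s - r\<bar>"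
    using ln_denom_lipschitz[OF B(2)] by blast
  have small: "\<forall>\<^sub>F N in sequentially. mesh N * real (k N) < B"
    using order_tendstoD(2)[OF mesh_k B(1)] .
  show ev: "\<forall>\<^sub>F N in sequentially. \<forall>j<k N. 0 < mgf_denom (1 - c / real N) \<theta> j"
    using small eventually_large
  proof eventually_elim
    case (elim N)
    have q: "0 < 1 - c / real N" using elim c by simp
    show ?case
    proof (intro allI impI)
      fix j assume "j < k N"
      then have "mesh N * real j \<le> mesh N * real (k N)"
        using elim by (intro mult_left_mono) auto
      then have "mesh N * real j \<le> B" using elim by linarith
      moreover have "0 \<le> mesh N * real j" using elim by simp
      ultimately have "0 < denom \<theta> (mesh N * real j)"
        using denom_pos[OF B(2)] by blast
      then show "0 < mgf_denom (1 - c / real N) \<theta> j"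
        by (simp add: mgf_denom_eq_denom[OF q] mesh_def)
    qed
  qed
  let ?S = "\<lambda>N. \<Sum>j<k N. ?\<phi> (mesh N * real j)"
  have "(\<lambda>N. L * (real N * mesh N)\<^sup>2 * (real (k N) / real N) * (1 / real N)) \<longlonglongrightarrow> L * c\<^sup>2 * t * 0"
    (is "?e \<longlonglongrightarrow> _")
    by (intro tendsto_intros mesh_scaled k lim_1_over_n)
  then have "?e \<longlonglongrightarrow> 0" by simp
  moreover have "\<forall>\<^sub>F N in sequentially. norm (mesh N * ?S N - Phi \<theta> (mesh N * real (k N)))
      \<le> L * (real N * mesh N)\<^sup>2 * (real (k N) / real N) * (1 / real N)"
    using small eventually_large eventually_gt_at_top[of 0]
  proof eventually_elim
    case (elim N)
    have "\<bar>mesh N * ?S N - (Phi \<theta> (mesh N * real (k N)) - Phi \<theta> 0)\<bar> \<le> L * (mesh N)\<^sup>2 * real (k N)"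
      by (rule riemann_sum_bound[OF Phi_derivative_x[OF B(2)] lip]) (use elim in auto)
    then show ?case using elim by (simp add: power_mult_distrib power2_eq_square)
  qed
  ultimately have err: "(\<lambda>N. mesh N * ?S N - Phi \<theta> (mesh N * real (k N))) \<longlonglongrightarrow> 0"
    by (rule Lim_null_comparison[rotated])
  have "continuous_on {0..B} (Phi \<theta>)"
    using Phi_derivative_x[OF B(2)] by (intro DERIV_continuous_on)
  then have "(\<lambda>N. Phi \<theta> (mesh N * real (k N))) \<longlonglongrightarrow> Phi \<theta> (c * t)"
  proof (rule continuous_on_tendsto_compose[OF _ mesh_k])
    show "c * t \<in> {0..B}" using ct B by simp
    show "\<forall>\<^sub>F N in sequentially. mesh N * real (k N) \<in> {0..B}"
      using small eventually_large by eventually_elim auto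
  qed
  from tendsto_add[OF err this] have "(\<lambda>N. mesh N * ?S N) \<longlonglongrightarrow> Phi \<theta> (c * t)"
    by simp
  \<comment> \<open>Dividing by \<open>N * mesh N\<close>, which tends to c, exchanges the grid
    width for 1/N; this is where the factor 1/c comes from.\<close>
  then have "(\<lambda>N. - (mesh N * ?S N / (real N * mesh N))) \<longlonglongrightarrow> - (Phi \<theta> (c * t) / c)"
    using c by (intro tendsto_intros mesh_scaled) auto
  then show "(\<lambda>N. ln (mgf (1 - c / real N) \<theta> (k N)) / real N) \<longlonglongrightarrow> - (Phi \<theta> (c * t) / c)"
  proof (rule Lim_transform_eventually)
    show "\<forall>\<^sub>F N in sequentially. - (mesh N * ?S N / (real N * mesh N))
        = ln (mgf (1 - c / real N) \<theta> (k N)) / real N"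
      using ev eventually_large eventually_gt_at_top[of 0]
    proof eventually_elim
      case (elim N)
      have q: "0 < 1 - c / real N" using elim c by simp
      have "ln (mgf (1 - c / real N) \<theta> (k N)) = - ?S N"
        using elim by (simp add: ln_mgf) (simp add: mgf_denom_eq_denom[OF q] mesh_def)
      then show ?case using elim by simp
    qed
  qed
qed

end

section \<open>The Hamiltonian system\<close>

text \<open>The difference quotient of exp(c w) at 0, continued to w = 0. With w = 1 - exp a, the
  value w = 0 stands for a = 0, the typical behaviour.\<close>

definition slope :: "real \<Rightarrow> real \<Rightarrow> real" where
  "slope c w = (if w = 0 then c else (exp (c * w) - 1) / w)"

text \<open>Closed form of the hitting time for initial momentum a, found by setting the last factor
  of \<open>unexp\<close> to zero; it gives T* at a = 0.\<close>

definition arrival :: "real \<Rightarrow> real \<Rightarrow> real" where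
  "arrival c a = ln (1 + slope c (1 - exp a)) / c"

text \<open>The fraction \<open>1 - x\<close> of unexplored vertices along the solution.\<close>

definition unexp :: "real \<Rightarrow> real \<Rightarrow> real \<Rightarrow> real" where
  "unexp c a s = exp a * denom a (c * s) * exp (- c * s)
     * (1 - (ln (denom a (c * s)) + a) / (c * (1 - exp a)))"

lemma exp_gt_line:
  assumes "x \<noteq> 0"
  shows "1 + x < exp (x :: real)"
proof -
  have "exp x \<noteq> 1 + x"
  proof
    assume "exp x = 1 + x"
    then have "exp x - 1 = x" by simp
    then have "ln (exp x) = exp x - 1" by (simp only: ln_exp)
    then have "exp x = 1" by (rule ln_eq_minus_one[OF exp_gt_zero])
    then show False using assms by simp
  qed
  then show ?thesis using exp_ge_add_one_self[of x] by linarith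
qed

lemma scaled_denom: "exp a * denom a x = 1 + (1 - exp a) * (exp x - 1)"
proof -
  have "exp a * exp (- a) = 1" by (simp flip: exp_add)
  then show ?thesis unfolding denom_def by algebra
qed

lemma ln_scaled_denom:
  assumes "0 < denom a x"
  shows "ln (denom a x) + a = ln (1 + (1 - exp a) * (exp x - 1))"
  unfolding scaled_denom[symmetric] using assms by (subst ln_mult) simp_all

context
  fixes c :: real assumes c: "0 < c"
begin

lemma slope_pos: "0 < slope c w"
  using c by (auto simp: slope_def zero_less_divide_iff mult_less_0_iff)

lemma slope_gt: "0 < w \<Longrightarrow> c < slope c w"
  using exp_gt_line[of "c * w"] c by (simp add: slope_def pos_less_divide_eq)

lemma slope_lt: "w < 0 \<Longrightarrow> slope c w < c"
  using exp_gt_line[of "c * w"] c by (simp add: slope_def neg_divide_less_eq)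

lemma slope_strict_mono_same_sign:
  assumes "v < w" "0 < v \<or> w < 0"
  shows "slope c v < slope c w"
proof -
  have "(exp (c * v) - 1) / v < (exp (c * w) - 1) / w"
  proof (rule DERIV_pos_imp_increasing[OF assms(1)])
    fix x assume "v \<le> x" "x \<le> w"
    then have x: "x \<noteq> 0" using assms by auto
    \<comment> \<open>Positivity of the numerator of the derivative is the strict inequality exp(y)
      > 1 + y at y = -c x.\<close>
    have "0 < exp (c * x) * (exp (- (c * x)) - (1 + - (c * x))) / x\<^sup>2"
      using exp_gt_line[of "- (c * x)"] x c by simp
    also have "\<dots> = (c * exp (c * x) * x - (exp (c * x) - 1)) / (x * x)"
      by (simp add: algebra_simps exp_minus power2_eq_square)
    finally have "0 < (c * exp (c * x) * x - (exp (c * x) - 1)) / (x * x)" .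
    moreover have "((\<lambda>x. (exp (c * x) - 1) / x) has_real_derivative
        (c * exp (c * x) * x - (exp (c * x) - 1)) / (x * x)) (at x)"
      using x by (auto intro!: derivative_eq_intros)
    ultimately show "\<exists>y. ((\<lambda>x. (exp (c * x) - 1) / x) has_real_derivative y) (at x) \<and> 0 < y"
      by blast
  qed
  then show ?thesis using assms by (auto simp: slope_def)
qed

lemma slope_strict_mono:
  assumes "v < w"
  shows "slope c v < slope c w"
proof -
  consider "0 < v \<or> w < 0" | "v \<le> 0" "0 < w" | "v < 0" "w = 0"
    using assms by linarith
  then show ?thesis
  proof cases
    case 1
    then show ?thesis by (rule slope_strict_mono_same_sign[OF assms])
  next
    case 2
    have "slope c v \<le> c" using slope_lt[of v] 2 by (cases "v = 0") (auto simp: slope_def)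
    then show ?thesis using slope_gt[OF 2(2)] by linarith
  next
    case 3
    then show ?thesis using slope_lt[of v] by (simp add: slope_def[of c 0])
  qed
qed

lemma slope_less_iff: "slope c v < slope c w \<longleftrightarrow> v < w"
  using slope_strict_mono[of v w] slope_strict_mono[of w v] by (cases v w rule: linorder_cases) auto

lemma slope_eq_iff: "slope c v = slope c w \<longleftrightarrow> v = w"
  using slope_strict_mono[of v w] slope_strict_mono[of w v] by (cases v w rule: linorder_cases) auto

lemma continuous_slope: "continuous_on UNIV (slope c)"
proof -
  have "isCont (slope c) w" for w
  proof (cases "w = 0")
    case True
    have "((\<lambda>w. exp (c * w)) has_real_derivative c) (at 0)"
      by (auto intro!: derivative_eq_intros)
    then have "((\<lambda>w. (exp (c * w) - 1) / w) \<longlongrightarrow> c) (at 0)"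
      by (simp add: DERIV_def)
    then have "(slope c \<longlongrightarrow> c) (at 0)"
      by (rule Lim_transform_eventually) (auto simp: slope_def eventually_at_filter)
    then show ?thesis by (simp add: True isCont_def slope_def)
  next
    case False
    have cont: "isCont (\<lambda>w. (exp (c * w) - 1) / w) w"
      using False by (intro continuous_intros) auto
    have ev: "\<forall>\<^sub>F x in nhds w. (exp (c * x) - 1) / x = slope c x"
      using t1_space_nhds[OF False] by eventually_elim (simp add: slope_def)
    show ?thesis using cont unfolding isCont_cong[OF ev] .
  qed
  then show ?thesis by (simp add: continuous_on_eq_continuous_at)
qed

text \<open>The values of \<open>slope c\<close> at 0 and 1 are the two bounds on A; w < 1 is what
  allows w = 1 - exp a.\<close>

lemma slope_surj_pos:
  assumes "c < A" "A < exp c - 1"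
  shows "\<exists>w. 0 < w \<and> w < 1 \<and> slope c w = A"
proof -
  have ends: "slope c 0 = c" "slope c 1 = exp c - 1" by (simp_all add: slope_def)
  have "\<exists>w\<ge>0. w \<le> 1 \<and> slope c w = A"
  proof (rule IVT')
    show "continuous_on {0..1} (slope c)"
      by (rule continuous_on_subset[OF continuous_slope subset_UNIV])
  qed (use assms in \<open>simp_all only: ends zero_le_one less_imp_le\<close>)
  then obtain w where w: "0 \<le> w" "w \<le> 1" "slope c w = A" by blast
  have "w \<noteq> 0" "w \<noteq> 1" using w(3) assms ends by (metis less_irrefl)+
  then show ?thesis using w by (metis less_eq_real_def)
qed

lemma slope_surj_neg:
  assumes "0 < A" "A < c"
  shows "\<exists>w<0. slope c w = A"
proof -
  \<comment> \<open>This v makes \<open>slope c v = (1 - exp (c * v)) * A\<close>, visibly at most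
    A, and so serves as left end for the intermediate value theorem.\<close>
  define v where "v = - inverse A"
  have v: "v < 0" "inverse v = - A" using assms(1) by (simp_all add: v_def)
  have "slope c v = (1 - exp (c * v)) * A"
    using v by (simp add: slope_def divide_inverse left_diff_distrib)
  also have "\<dots> \<le> 1 * A" using assms(1) by (intro mult_right_mono) simp_all
  finally have low: "slope c v \<le> A" by simp
  have zero: "slope c 0 = c" by (simp add: slope_def)
  have "\<exists>w\<ge>v. w \<le> 0 \<and> slope c w = A"
  proof (rule IVT')
    show "continuous_on {v..0} (slope c)"
      by (rule continuous_on_subset[OF continuous_slope subset_UNIV])
  qed (use assms v low in \<open>simp_all only: zero less_imp_le\<close>)
  then obtain w where w: "w \<le> 0" "slope c w = A" by blast
  have "w \<noteq> 0" using w(2) assms zero by (metis less_irrefl)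
  then show ?thesis using w by (metis less_eq_real_def)
qed

section \<open>Arrival time and explicit solution of the system\<close>

lemma exp_arrival: "exp (c * arrival c a) = 1 + slope c (1 - exp a)"
  using c slope_pos[of "1 - exp a"] by (simp add: arrival_def)

lemma arrival_pos: "0 < arrival c a"
  using c slope_pos[of "1 - exp a"] by (simp add: arrival_def ln_gt_zero)

lemma arrival_eq_iff: "arrival c a = t \<longleftrightarrow> slope c (1 - exp a) = exp (c * t) - 1"
proof -
  have "arrival c a = t \<longleftrightarrow> exp (c * arrival c a) = exp (c * t)" using c by simp
  also have "\<dots> \<longleftrightarrow> slope c (1 - exp a) = exp (c * t) - 1"
    unfolding exp_arrival by linarith
  finally show ?thesis .
qed

lemma arrival_less_1: "arrival c a < 1"
proof -
  have "slope c (1 - exp a) < slope c 1" by (rule slope_strict_mono) simp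
  moreover have "slope c 1 = exp (c * 1) - 1" by (simp add: slope_def)
  ultimately have "exp (c * arrival c a) < exp (c * 1)" unfolding exp_arrival by linarith
  then show ?thesis using c by simp
qed

text \<open>Both sides compare \<open>1 + w * A\<close> with exp(c w); for w < 0 the order is
  reversed twice, by dividing by c w and by w. It serves two purposes: as a condition on time it
  tells when x reaches 1, and as a condition on the tilt it gives the sign of the derivative of
  \<open>rate\<close>.\<close>

lemma ratio_iff:
  assumes "w \<noteq> 0" "0 < 1 + w * A"
  shows "ln (1 + w * A) / (c * w) < 1 \<longleftrightarrow> A < slope c w"
    and "ln (1 + w * A) / (c * w) = 1 \<longleftrightarrow> A = slope c w"
proof -
  have lt: "ln (1 + w * A) < c * w \<longleftrightarrow> 1 + w * A < exp (c * w)"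
    and gt: "ln (1 + w * A) > c * w \<longleftrightarrow> 1 + w * A > exp (c * w)"
    using ln_less_cancel_iff[of "1 + w * A" "exp (c * w)"] ln_less_cancel_iff[of "exp (c * w)" "1 + w * A"]
      assms(2) by simp_all
  have eq: "ln (1 + w * A) = c * w \<longleftrightarrow> 1 + w * A = exp (c * w)"
    using lt gt by linarith
  show "ln (1 + w * A) / (c * w) = 1 \<longleftrightarrow> A = slope c w"
    using eq assms(1) c by (auto simp: slope_def field_simps)
  show "ln (1 + w * A) / (c * w) < 1 \<longleftrightarrow> A < slope c w"
  proof (cases "0 < w")
    case True
    then have "ln (1 + w * A) / (c * w) < 1 \<longleftrightarrow> ln (1 + w * A) < c * w"
      using c by (simp add: divide_less_eq_1_pos)
    also have "\<dots> \<longleftrightarrow> A < slope c w"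
      using lt True by (auto simp: slope_def field_simps)
    finally show ?thesis .
  next
    case False
    then have w: "w < 0" using assms by simp
    then have "c * w < 0" using c by (simp add: mult_less_0_iff)
    then have "ln (1 + w * A) / (c * w) < 1 \<longleftrightarrow> ln (1 + w * A) > c * w"
      by (simp add: divide_less_eq_1_neg)
    also have "\<dots> \<longleftrightarrow> A < slope c w"
      using gt w by (auto simp: slope_def field_simps)
    finally show ?thesis .
  qed
qed

lemma denom_arrival: "a \<noteq> 0 \<Longrightarrow> denom a (c * arrival c a) = exp (- a) * exp (c * (1 - exp a))"
proof -
  assume a: "a \<noteq> 0"
  have "exp a * denom a (c * arrival c a) = exp (c * (1 - exp a))"
    unfolding scaled_denom exp_arrival using a by (simp add: slope_def)
  then show ?thesis by (simp add: exp_minus field_simps)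
qed

lemma denom_arrival_pos: "a \<noteq> 0 \<Longrightarrow> 0 < denom a (c * arrival c a)"
  by (simp add: denom_arrival)

lemma unexp_pos_iff:
  assumes "a \<noteq> 0" "0 < denom a (c * s)"
  shows "0 < unexp c a s \<longleftrightarrow> s < arrival c a" and "unexp c a (arrival c a) = 0"
proof -
  let ?w = "1 - exp a"
  have w: "?w \<noteq> 0" using assms by simp
  have A: "0 < 1 + ?w * (exp (c * s) - 1)"
    using assms(2) by (simp flip: scaled_denom)
  have "0 < unexp c a s \<longleftrightarrow> ln (1 + ?w * (exp (c * s) - 1)) / (c * ?w) < 1"
  proof -
    have "0 < exp a * denom a (c * s) * exp (- c * s)" using assms by simp
    then show ?thesis
      unfolding unexp_def ln_scaled_denom[OF assms(2)]
      by (metis diff_gt_0_iff_gt mult_pos_pos zero_less_mult_pos)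
  qed
  also have "\<dots> \<longleftrightarrow> exp (c * s) - 1 < slope c ?w"
    by (rule ratio_iff(1)[OF w A])
  also have "\<dots> \<longleftrightarrow> exp (c * s) < exp (c * arrival c a)"
    by (auto simp: exp_arrival)
  finally show "0 < unexp c a s \<longleftrightarrow> s < arrival c a"
    using c by simp
  have B: "0 < 1 + ?w * (exp (c * arrival c a) - 1)"
    using denom_arrival_pos[OF assms(1)] by (simp flip: scaled_denom)
  have "ln (1 + ?w * (exp (c * arrival c a) - 1)) / (c * ?w) = 1"
    unfolding ratio_iff(2)[OF w B] by (simp add: exp_arrival)
  then show "unexp c a (arrival c a) = 0"
    unfolding unexp_def ln_scaled_denom[OF denom_arrival_pos[OF assms(1)]]
    by (simp only: diff_self mult_zero_right)
qed

lemma denom_derivative: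
  "((\<lambda>s. denom a (c * s)) has_real_derivative c * (denom a (c * s) - 1)) (at s within S)"
  unfolding denom_def by (auto intro!: derivative_eq_intros)

lemma unexp_derivative:
  assumes "a \<noteq> 0" "0 < denom a (c * s)"
  shows "(unexp c a has_real_derivative - 1 - c * unexp c a s / denom a (c * s)) (at s within S)"
proof -
  let ?d = "denom a (c * s)" and ?w = "1 - exp a"
  let ?l = "1 - (ln ?d + a) / (c * ?w)"
  have w: "?w \<noteq> 0" using assms by simp
  \<comment> \<open>Turns the last term of the product rule into exactly 1, the -1 in the equation
    for 1 - x.\<close>
  have ed: "exp a * exp (- (c * s)) * (?d - 1) = ?w"
    by (simp add: denom_def exp_minus field_simps)
  have der: "(unexp c a has_real_derivative
      (exp a * (c * (?d - 1)) * exp (- (c * s)) + exp a * ?d * (- c * exp (- (c * s)))) * ?l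
      - exp a * ?d * exp (- (c * s)) * (c * (?d - 1) / ?d / (c * ?w))) (at s within S)"
  proof -
    have "((\<lambda>s. exp a * denom a (c * s) * exp (- c * s)) has_real_derivative
        exp a * (c * (?d - 1)) * exp (- (c * s)) + exp a * ?d * (- c * exp (- (c * s)))) (at s within S)"
      by (auto intro!: derivative_eq_intros denom_derivative)
    moreover have "((\<lambda>s. 1 - (ln (denom a (c * s)) + a) / (c * ?w)) has_real_derivative
        - (c * (?d - 1) / ?d / (c * ?w))) (at s within S)"
      using assms(2) w c by (auto intro!: derivative_eq_intros denom_derivative)
    ultimately have "((\<lambda>s. exp a * denom a (c * s) * exp (- c * s)
        * (1 - (ln (denom a (c * s)) + a) / (c * ?w))) has_real_derivative
        (exp a * (c * (?d - 1)) * exp (- (c * s)) + exp a * ?d * (- c * exp (- (c * s)))) * ?l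
        + - (c * (?d - 1) / ?d / (c * ?w)) * (exp a * ?d * exp (- c * s))) (at s within S)"
      by (rule DERIV_mult)
    then show ?thesis
      unfolding unexp_def[abs_def] by (simp add: mult.commute)
  qed
  have e1: "(exp a * (c * (?d - 1)) * exp (- (c * s)) + exp a * ?d * (- c * exp (- (c * s)))) * ?l
      = - c * (exp a * exp (- (c * s)) * ?l)"
    by (simp add: algebra_simps)
  have e2: "exp a * exp (- (c * s)) * ?l = unexp c a s / ?d"
    using assms by (simp add: unexp_def)
  have e3: "exp a * ?d * exp (- (c * s)) * (c * (?d - 1) / ?d / (c * ?w)) = 1"
  proof -
    have "exp a * ?d * exp (- (c * s)) * (c * (?d - 1) / ?d / (c * ?w))
        = exp a * exp (- (c * s)) * (?d - 1) / ?w"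
      using assms c by simp
    then show ?thesis using ed w by simp
  qed
  show ?thesis
    using der unfolding e1 e2 e3 by (rule DERIV_cong) simp
qed

lemma unexp_0: "a \<noteq> 0 \<Longrightarrow> unexp c a 0 = 1"
  by (simp add: unexp_def denom_0 flip: exp_add)

lemma ode_solution_exists:
  assumes "a \<noteq> 0" "0 \<le> t" "0 < denom a (c * t)"
  shows "ode_solution c a t (\<lambda>s. 1 - unexp c a s) (\<lambda>s. - ln (denom a (c * s)))"
  unfolding ode_solution_def
proof (intro conjI ballI)
  show "1 - unexp c a 0 = 0" using assms by (simp add: unexp_0)
  show "- ln (denom a (c * 0)) = a" by (simp add: denom_0)
  fix s assume s: "s \<in> {0..t}"
  have d: "0 < denom a (c * s)"
    by (rule denom_pos[OF assms(3)]) (use s c in auto)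
  have e: "exp (- ln (denom a (c * s))) = 1 / denom a (c * s)"
    using d by (simp add: exp_minus field_simps)
  show "((\<lambda>s. 1 - unexp c a s) has_real_derivative
      1 + c * (1 - (1 - unexp c a s)) * exp (- ln (denom a (c * s)))) (at s within {0..t})"
    unfolding e by (rule derivative_eq_intros unexp_derivative assms d refl)+ simp
  show "((\<lambda>s. - ln (denom a (c * s))) has_real_derivative
      c * (exp (- ln (denom a (c * s))) - 1)) (at s within {0..t})"
  proof -
    have "((\<lambda>s. - ln (denom a (c * s))) has_real_derivative
        - (c * (denom a (c * s) - 1) / denom a (c * s))) (at s within {0..t})"
      using d by (auto intro!: derivative_eq_intros denom_derivative)
    moreover have "- (c * (denom a (c * s) - 1) / denom a (c * s)) = c * (1 / denom a (c * s) - 1)"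
      using d by (simp add: field_simps)
    ultimately show ?thesis unfolding e by simp
  qed
qed

text \<open>Two conserved quantities take the place of a general uniqueness theorem. The one for
  \<alpha> also shows that a solution up to time t forces \<open>denom\<close> to be positive there,
  which rules out times after the explosion.\<close>

lemma ode_solution_unique:
  assumes "a \<noteq> 0" "0 \<le> t" and sol: "ode_solution c a t x \<alpha>"
  shows "0 < denom a (c * t)" and "x t = 1 - unexp c a t"
proof -
  have x0: "x 0 = 0" and a0: "\<alpha> 0 = a"
    and dx: "\<And>s. s \<in> {0..t} \<Longrightarrow> (x has_real_derivative 1 + c * (1 - x s) * exp (\<alpha> s)) (at s within {0..t})"
    and da: "\<And>s. s \<in> {0..t} \<Longrightarrow> (\<alpha> has_real_derivative c * (exp (\<alpha> s) - 1)) (at s within {0..t})"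
    using sol by (auto simp: ode_solution_def)
  have "\<exists>k. \<forall>s\<in>{0..t}. (exp (- \<alpha> s) - 1) * exp (- (c * s)) = k"
  proof (rule has_field_derivative_zero_constant)
    fix s assume "s \<in> {0..t}"
    have "exp (- \<alpha> s) * exp (\<alpha> s) = 1" by (simp flip: exp_add)
    then have "- (c * (exp (\<alpha> s) - 1)) * exp (- \<alpha> s) * exp (- (c * s))
        + - c * exp (- (c * s)) * (exp (- \<alpha> s) - 1) = 0"
      by algebra
    then show "((\<lambda>s. (exp (- \<alpha> s) - 1) * exp (- (c * s))) has_real_derivative 0) (at s within {0..t})"
      by (auto intro!: derivative_eq_intros da \<open>s \<in> {0..t}\<close> simp: algebra_simps)
  qed simp
  then obtain k where k: "\<And>s. s \<in> {0..t} \<Longrightarrow> (exp (- \<alpha> s) - 1) * exp (- (c * s)) = k" by blast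
  have "k = exp (- a) - 1" using k[of 0] assms a0 by simp
  then have d: "exp (- \<alpha> s) = denom a (c * s)" if "s \<in> {0..t}" for s
  proof -
    have "exp (- (c * s)) * exp (c * s) = 1" by (simp flip: exp_add)
    then show ?thesis
      using k[OF that] \<open>k = exp (- a) - 1\<close> unfolding denom_def by algebra
  qed
  have dpos: "0 < denom a (c * s)" if "s \<in> {0..t}" for s
    using d[OF that] by (metis exp_gt_zero)
  show "0 < denom a (c * t)" using dpos assms by simp
  \<comment> \<open>The difference D between \<open>x\<close> and the explicit solution satisfies D'
    = -c D / denom, and exp(c s) / denom is an integrating factor.\<close>
  have "\<exists>k. \<forall>s\<in>{0..t}. (x s - (1 - unexp c a s)) * (exp (c * s) / denom a (c * s)) = k"
  proof (rule has_field_derivative_zero_constant)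
    fix s assume s: "s \<in> {0..t}"
    let ?d = "denom a (c * s)" and ?u = "unexp c a s"
    have e: "exp (\<alpha> s) = 1 / ?d"
      using d[OF s] by (metis exp_minus inverse_eq_divide inverse_inverse_eq)
    have "((\<lambda>s. x s - (1 - unexp c a s)) has_real_derivative
        1 + c * (1 - x s) * exp (\<alpha> s) - (0 - (- 1 - c * ?u / ?d))) (at s within {0..t})"
      by (intro DERIV_diff DERIV_const dx[OF s] unexp_derivative assms(1) dpos[OF s])
    moreover have "((\<lambda>s. exp (c * s) / denom a (c * s)) has_real_derivative
        (exp (c * s) * c * ?d - exp (c * s) * (c * (?d - 1))) / (?d * ?d)) (at s within {0..t})"
      using dpos[OF s] by (intro DERIV_divide denom_derivative) (auto intro!: derivative_eq_intros)
    ultimately have "((\<lambda>s. (x s - (1 - unexp c a s)) * (exp (c * s) / denom a (c * s))) has_real_derivative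
        (1 + c * (1 - x s) * exp (\<alpha> s) - (0 - (- 1 - c * ?u / ?d))) * (exp (c * s) / ?d)
        + (exp (c * s) * c * ?d - exp (c * s) * (c * (?d - 1))) / (?d * ?d) * (x s - (1 - ?u)))
        (at s within {0..t})"
      by (rule DERIV_mult)
    moreover have "(1 + c * (1 - x s) * exp (\<alpha> s) - (0 - (- 1 - c * ?u / ?d))) * (exp (c * s) / ?d)
        + (exp (c * s) * c * ?d - exp (c * s) * (c * (?d - 1))) / (?d * ?d) * (x s - (1 - ?u)) = 0"
      unfolding e using dpos[OF s] by (simp add: field_simps)
    ultimately show "((\<lambda>s. (x s - (1 - unexp c a s)) * (exp (c * s) / denom a (c * s))) has_real_derivative 0)
        (at s within {0..t})"
      by simp
  qed simp
  then obtain l where l: "\<And>s. s \<in> {0..t} \<Longrightarrow> (x s - (1 - unexp c a s)) * (exp (c * s) / denom a (c * s)) = l"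
    by blast
  have "l = 0" using l[of 0] x0 assms by (simp add: unexp_0)
  then show "x t = 1 - unexp c a t" using l[of t] dpos[of t] assms(2) by simp
qed

lemma x_sol_eq:
  assumes "a \<noteq> 0" "0 \<le> t" "0 < denom a (c * t)"
  shows "x_sol c a t = 1 - unexp c a t"
  unfolding x_sol_def
proof (rule the_equality)
  show "\<exists>x \<alpha>. ode_solution c a t x \<alpha> \<and> 1 - unexp c a t = x t"
    using ode_solution_exists[OF assms] by blast
  show "v = 1 - unexp c a t" if "\<exists>x \<alpha>. ode_solution c a t x \<alpha> \<and> v = x t" for v
    using that ode_solution_unique(2)[OF assms(1,2)] by blast
qed

lemma hit_time_eq:
  assumes "a \<noteq> 0"
  shows "hit_time c a = arrival c a"
  unfolding hit_time_def
proof (rule cInf_eq_minimum)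
  show "arrival c a \<in> {t \<in> {0..1}. (\<exists>x \<alpha>. ode_solution c a t x \<alpha>) \<and> x_sol c a t \<ge> 1}"
    using ode_solution_exists[OF assms _ denom_arrival_pos[OF assms]] arrival_pos[of a]
      arrival_less_1[of a] x_sol_eq[OF assms _ denom_arrival_pos[OF assms]]
      unexp_pos_iff(2)[OF assms denom_arrival_pos[OF assms]]
    by (auto simp: less_imp_le)
  fix t assume "t \<in> {t \<in> {0..1}. (\<exists>x \<alpha>. ode_solution c a t x \<alpha>) \<and> x_sol c a t \<ge> 1}"
  then obtain x \<alpha> where t: "0 \<le> t" and "ode_solution c a t x \<alpha>" and "x_sol c a t \<ge> 1"
    by auto
  moreover from this have d: "0 < denom a (c * t)"
    using ode_solution_unique(1)[OF assms] by blast
  ultimately have "\<not> 0 < unexp c a t" using x_sol_eq[OF assms t d] by simp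
  then show "arrival c a \<le> t" using unexp_pos_iff(1)[OF assms d] by simp
qed

text \<open>With u = 1 - x, \<alpha> = -ln denom and H = \<alpha> + c u (exp \<alpha> - 1), the cost
  along the solution is \<alpha> x' - H. A primitive is \<open>?G\<close>, whose first summand
  vanishes on arrival, as u = 0, and equals -a at time 0.\<close>

lemma path_cost_eq:
  assumes a: "a \<noteq> 0"
  shows "path_cost c a = ereal (a + Phi a (c * arrival c a) / c)"
proof -
  let ?T = "arrival c a"
  let ?d = "\<lambda>s. denom a (c * s)"
  let ?f = "\<lambda>s. c * unexp c a s * ((- ln (?d s) - 1) / ?d s + 1)"
  let ?G = "\<lambda>s. unexp c a s * ln (?d s) + Phi a (c * s) / c"
  have d: "0 < ?d s" if "s \<in> {0..?T}" for s
    by (rule denom_pos[OF denom_arrival_pos[OF a]]) (use that c in auto)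
  have u: "0 < unexp c a s" if "s \<in> {0..<?T}" for s
    using unexp_pos_iff(1)[OF a d] that by auto
  have cost: "cost c (x_sol c a s) (deriv (x_sol c a) s) = ereal (?f s)" if s: "s \<in> {0<..<?T}" for s
  proof -
    have ds: "0 < ?d s" and us: "0 < unexp c a s" using d u s by auto
    have "\<forall>\<^sub>F r in nhds s. r \<in> {0<..<?T}"
      using s by (intro eventually_nhds_in_open) auto
    then have ev: "\<forall>\<^sub>F r in nhds s. x_sol c a r = 1 - unexp c a r"
      by eventually_elim (use d in \<open>auto intro!: x_sol_eq[OF a]\<close>)
    have "((\<lambda>r. 1 - unexp c a r) has_real_derivative 1 + c * unexp c a s / ?d s) (at s)"
      by (rule derivative_eq_intros unexp_derivative a ds refl)+ simp
    then have "deriv (\<lambda>r. 1 - unexp c a r) s = 1 + c * unexp c a s / ?d s"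
      by (rule DERIV_imp_deriv)
    \<comment> \<open>\<open>deriv\<close> sees a neighbourhood of s: \<open>x_sol\<close> agrees
      with the explicit solution near s because s is interior.\<close>
    then have der: "deriv (x_sol c a) s = 1 + c * unexp c a s / ?d s"
      using deriv_cong_ev[OF ev refl] by simp
    define v where "v = c * unexp c a s / ?d s"
    have v: "0 < v" using us c ds by (simp add: v_def)
    have "v / (c * unexp c a s) = 1 / ?d s"
      using us c by (simp add: v_def)
    then have "ln (v / (c * unexp c a s)) = - ln (?d s)"
      using ds by (simp add: ln_div)
    then have "cost c (1 - unexp c a s) (1 + v) = ereal (v * (- ln (?d s) - 1) + c * unexp c a s)"
      using us v by (simp add: cost_def)
    also have "v * (- ln (?d s) - 1) + c * unexp c a s = ?f s"
      by (simp add: v_def algebra_simps)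
    finally show ?thesis
      using eventually_nhds_x_imp_x[OF ev] by (simp add: der v_def)
  qed
  \<comment> \<open>This rests on ln d <= d - 1; it lets the nonnegative integral of the definition
    be computed as an ordinary one.\<close>
  have nonneg: "0 \<le> ?f s" if "s \<in> {0..?T}" for s
  proof -
    have "0 \<le> unexp c a s"
      using u[of s] unexp_pos_iff(2)[OF a d[OF that]] that by (cases "s = ?T") auto
    moreover have "0 \<le> (- ln (?d s) - 1) / ?d s + 1"
      using ln_le_minus_one[OF d[OF that]] d[OF that] by (simp add: field_simps)
    ultimately show ?thesis using c by simp
  qed
  have "(?f has_integral (?G ?T - ?G 0)) {0..?T}"
  proof (rule fundamental_theorem_of_calculus_interior)
    show "0 \<le> ?T" using arrival_pos[of a] by simp
    have "continuous_on {0..c * ?T} (Phi a)"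
      using Phi_derivative_x[OF denom_arrival_pos[OF a]] by (intro DERIV_continuous_on)
    then have "continuous_on {0..?T} (\<lambda>s. Phi a (c * s))"
      by (rule continuous_on_compose2) (use c in \<open>auto intro!: continuous_intros\<close>)
    moreover have "continuous_on {0..?T} (unexp c a)"
      using unexp_derivative[OF a d] by (intro DERIV_continuous_on)
    ultimately show "continuous_on {0..?T} ?G"
      by (intro continuous_intros ballI) (use d c in \<open>auto simp: less_imp_neq[THEN not_sym]\<close>)
    fix s assume s: "s \<in> {0<..<?T}"
    then have ds: "0 < ?d s" using d by auto
    have "(Phi a has_real_derivative ln (?d s)) (at (c * s) within {0..c * ?T})"
      by (rule Phi_derivative_x[OF denom_arrival_pos[OF a]]) (use s c in auto)
    moreover have "at (c * s) within {0..c * ?T} = at (c * s)"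
      using s c by (intro at_within_interior) (auto simp: interior_atLeastAtMost_real)
    ultimately have Phi': "(Phi a has_real_derivative ln (?d s)) (at (c * s))" by simp
    have "((\<lambda>s. Phi a (c * s)) has_real_derivative ln (?d s) * c) (at s)"
      by (rule DERIV_chain2[where g = "(*) c", OF Phi']) (auto intro!: derivative_eq_intros)
    then have "(?G has_real_derivative (- 1 - c * unexp c a s / ?d s) * ln (?d s)
        + c * (?d s - 1) / ?d s * unexp c a s + ln (?d s) * c / c) (at s)"
      using ds c
      by (auto intro!: derivative_eq_intros unexp_derivative[OF a ds] denom_derivative)
    moreover have "(- 1 - c * unexp c a s / ?d s) * ln (?d s)
        + c * (?d s - 1) / ?d s * unexp c a s + ln (?d s) * c / c = ?f s"
      using ds c by (simp add: field_simps)
    ultimately show "(?G has_vector_derivative ?f s) (at s)"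
      by (simp add: has_real_derivative_iff_has_vector_derivative)
  qed
  moreover have "?G ?T - ?G 0 = a + Phi a (c * ?T) / c"
    by (simp add: unexp_0[OF a] denom_0 unexp_pos_iff(2)[OF a denom_arrival_pos[OF a]])
  ultimately have int: "(?f has_integral (a + Phi a (c * ?T) / c)) {0..?T}"
    by (simp only:)
  have "(\<integral>\<^sup>+t\<in>{0..?T}. e2ennreal (cost c (x_sol c a t) (deriv (x_sol c a) t)) \<partial>lborel)
      = (\<integral>\<^sup>+t\<in>{0..?T}. ennreal (?f t) \<partial>lborel)"
  proof (rule nn_integral_cong_AE)
    have "AE t in lborel. t \<notin> {0, ?T}"
      by (intro AE_not_in countable_imp_null_set_lborel) auto
    then show "AE t in lborel. e2ennreal (cost c (x_sol c a t) (deriv (x_sol c a) t)) * indicator {0..?T} t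
        = ennreal (?f t) * indicator {0..?T} t"
      by eventually_elim (use cost in \<open>auto split: split_indicator simp: e2ennreal_ereal\<close>)
  qed
  also have "\<dots> = ennreal (a + Phi a (c * ?T) / c)"
    by (rule nn_integral_has_integral_lebesgue'[OF nonneg int])
  finally have "path_cost c a = enn2ereal (ennreal (a + Phi a (c * ?T) / c))"
    by (simp add: path_cost_def hit_time_eq[OF a])
  moreover have "0 \<le> a + Phi a (c * ?T) / c"
    by (rule has_integral_nonneg[OF int nonneg])
  ultimately show ?thesis by (simp add: enn2ereal_ennreal)
qed

end

section \<open>Exponential rates\<close>

text \<open>The exponent of \<open>wave\<close> at n = N: with \<Lambda> the limit of
  \<open>ln mgf / N\<close> it is \<theta> - \<Lambda>(\<theta>), the quantity maximised in the
  Legendre transform at 1.\<close>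

definition rate :: "real \<Rightarrow> real \<Rightarrow> real \<Rightarrow> real" where
  "rate c t \<theta> = \<theta> + Phi \<theta> (c * t) / c"

context
  fixes c a t :: real
  assumes c: "0 < c" and a: "a \<noteq> 0" and t: "t = arrival c a"
begin

lemma t_pos: "0 < t"
  using arrival_pos[OF c, of a] t by simp

lemma ct_nonneg: "0 \<le> c * t"
  using c t_pos by simp

lemma denom_t_pos: "0 < denom a (c * t)"
  using denom_arrival_pos[OF c a] t by simp

text \<open>The closed form of the derivative of \<open>Phi\<close> in \<theta> divides by 1 - exp
  \<theta>, hence \<theta> is not 0. The sign comes from \<open>ratio_iff\<close> with time fixed
  and the tilt varying: exp(c t) - 1 is the slope belonging to a.\<close>

lemma rate_derivative:
  assumes "\<theta> \<noteq> 0" "0 < denom \<theta> (c * t)"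
  obtains r where "((rate c t) has_real_derivative r) (at \<theta>)"
    "0 < r \<longleftrightarrow> \<theta> < a" "r = 0 \<longleftrightarrow> \<theta> = a"
proof -
  let ?w = "1 - exp \<theta>" and ?A = "exp (c * t) - 1"
  let ?r = "1 - (ln (denom \<theta> (c * t)) + \<theta>) / (c * ?w)"
  have w: "?w \<noteq> 0" using assms by simp
  have A: "0 < 1 + ?w * ?A"
    using assms(2) by (simp flip: scaled_denom)
  have slope: "?A = slope c (1 - exp a)"
    using exp_arrival[OF c, of a] t by simp
  have r: "?r = 1 - ln (1 + ?w * ?A) / (c * ?w)"
    by (simp add: ln_scaled_denom[OF assms(2)])
  have "((\<lambda>\<theta>. \<theta> + Phi \<theta> (c * t) / c) has_real_derivative
      1 + - ((ln (denom \<theta> (c * t)) + \<theta>) / ?w) / c) (at \<theta>)"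
    by (intro DERIV_add DERIV_ident DERIV_cdivide Phi_derivative_theta assms ct_nonneg)
  then have 1: "(rate c t has_real_derivative ?r) (at \<theta>)"
    by (simp add: rate_def[abs_def] mult.commute)
  have "0 < ?r \<longleftrightarrow> ln (1 + ?w * ?A) / (c * ?w) < 1" unfolding r by linarith
  also have "\<dots> \<longleftrightarrow> \<theta> < a"
    unfolding ratio_iff(1)[OF c w A] unfolding slope slope_less_iff[OF c] by simp
  finally have 2: "0 < ?r \<longleftrightarrow> \<theta> < a" .
  have "?r = 0 \<longleftrightarrow> ln (1 + ?w * ?A) / (c * ?w) = 1" unfolding r by linarith
  also have "\<dots> \<longleftrightarrow> \<theta> = a"
    unfolding ratio_iff(2)[OF c w A] unfolding slope slope_eq_iff[OF c] by auto
  finally have 3: "?r = 0 \<longleftrightarrow> \<theta> = a" .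
  show thesis by (rule that[OF 1 2 3])
qed

lemma rate_continuous:
  assumes "\<theta> \<noteq> 0" "0 < denom \<theta> (c * t)"
  shows "isCont (rate c t) \<theta>"
  using rate_derivative[OF assms] DERIV_isCont by blast

lemma rate_derivative_0: "(rate c t has_real_derivative 0) (at a)"
  using rate_derivative[OF a denom_t_pos] by metis

text \<open>Since a < 0, moving left never meets the excluded point 0, and positivity of
  \<open>denom\<close> is inherited from a.\<close>

lemma rate_less_left:
  assumes "\<theta> < a" "a < 0"
  shows "rate c t \<theta> < rate c t a"
proof (rule DERIV_pos_imp_increasing_open[OF assms(1)])
  have d: "0 < denom z (c * t)" if "z \<le> a" for z
    using denom_antimono[OF that, of "c * t"] denom_t_pos by linarith
  fix z assume "\<theta> < z" "z < a"
  then show "\<exists>y. (rate c t has_real_derivative y) (at z) \<and> 0 < y"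
    using rate_derivative[of z] d[of z] assms by (metis less_imp_le less_irrefl less_trans)
next
  have d: "0 < denom z (c * t)" if "z \<le> a" for z
    using denom_antimono[OF that, of "c * t"] denom_t_pos by linarith
  show "continuous_on {\<theta>..a} (rate c t)"
    by (intro continuous_at_imp_continuous_on ballI rate_continuous) (use d assms in auto)
qed

lemma rate_less_right:
  assumes "0 < a" "a < \<theta>" "0 < denom \<theta> (c * t)"
  shows "rate c t \<theta> < rate c t a"
proof (rule DERIV_neg_imp_decreasing_open[OF assms(2)])
  have d: "0 < denom z (c * t)" if "z \<le> \<theta>" for z
    using denom_antimono[OF that, of "c * t"] assms by linarith
  fix z assume z: "a < z" "z < \<theta>"
  then have "z \<noteq> 0" using assms by simp
  then obtain r where "(rate c t has_real_derivative r) (at z)"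
    "0 < r \<longleftrightarrow> z < a" "r = 0 \<longleftrightarrow> z = a"
    using rate_derivative[of z] d[of z] z by (metis less_imp_le)
  with z show "\<exists>y. (rate c t has_real_derivative y) (at z) \<and> y < 0"
    by (intro exI[of _ r]) auto
next
  have d: "0 < denom z (c * t)" if "z \<le> \<theta>" for z
    using denom_antimono[OF that, of "c * t"] assms by linarith
  show "continuous_on {a..\<theta>} (rate c t)"
    by (intro continuous_at_imp_continuous_on ballI rate_continuous) (use d assms in auto)
qed

end

section \<open>Comparison of sequences on the exponential scale\<close>

lemma eventually_exp_le:
  fixes U :: "nat \<Rightarrow> real"
  assumes "(\<lambda>N. ln (U N) / real N) \<longlonglongrightarrow> u" "\<forall>\<^sub>F N in sequentially. 0 < U N" "l < u"
  shows "\<forall>\<^sub>F N in sequentially. exp (real N * l) \<le> U N"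
  using order_tendstoD(1)[OF assms(1,3)] assms(2) eventually_gt_at_top[of 0]
proof eventually_elim
  case (elim N)
  then have "real N * l < ln (U N)" by (simp add: pos_less_divide_eq mult.commute)
  then have "exp (real N * l) < exp (ln (U N))" by simp
  then show ?case using elim by simp
qed

text \<open>The factor 4 leaves at least half of U after two such terms are subtracted.\<close>

lemma eventually_negligible:
  fixes U V :: "nat \<Rightarrow> real"
  assumes "(\<lambda>N. ln (U N) / real N) \<longlonglongrightarrow> u" "\<forall>\<^sub>F N in sequentially. 0 < U N"
    and "(\<lambda>N. ln (V N) / real N) \<longlonglongrightarrow> v" "\<forall>\<^sub>F N in sequentially. 0 < V N" and "v < u"
  shows "\<forall>\<^sub>F N in sequentially. 4 * V N \<le> U N"
proof -
  have "(\<lambda>N. ln (U N) / real N - ln (V N) / real N - ln 4 / real N) \<longlonglongrightarrow> u - v - 0"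
    by (intro tendsto_diff assms) real_asymp
  then have "\<forall>\<^sub>F N in sequentially. 0 < ln (U N) / real N - ln (V N) / real N - ln 4 / real N"
    using assms(5) by (intro order_tendstoD(1)) auto
  then show ?thesis using assms(2,4) eventually_gt_at_top[of 0]
  proof eventually_elim
    case (elim N)
    have "0 < (ln (U N) - ln (V N) - ln 4) / real N"
      using elim(1) by (simp add: diff_divide_distrib)
    then have "ln (4 * V N) < ln (U N)"
      using elim by (simp add: zero_less_divide_iff ln_mult)
    then have "4 * V N < U N" using elim by (subst (asm) ln_less_cancel_iff) auto
    then show ?case by simp
  qed
qed

lemma eventually_exp_le_combination:
  fixes C U V W P :: "nat \<Rightarrow> real"
  assumes "\<forall>\<^sub>F N in sequentially. C N * (U N - V N - W N) \<le> P N"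
    and pos: "\<forall>\<^sub>F N in sequentially. 0 < C N \<and> 0 < U N \<and> 0 < V N \<and> 0 < W N"
    and lim: "(\<lambda>N. ln (C N) / real N) \<longlonglongrightarrow> k" "(\<lambda>N. ln (U N) / real N) \<longlonglongrightarrow> u"
      "(\<lambda>N. ln (V N) / real N) \<longlonglongrightarrow> v" "(\<lambda>N. ln (W N) / real N) \<longlonglongrightarrow> w"
    and less: "v < u" "w < u" "l < k + u"
  shows "\<forall>\<^sub>F N in sequentially. exp (real N * l) \<le> P N"
proof -
  have p: "\<forall>\<^sub>F N in sequentially. 0 < U N" "\<forall>\<^sub>F N in sequentially. 0 < V N"
    "\<forall>\<^sub>F N in sequentially. 0 < W N" "\<forall>\<^sub>F N in sequentially. 0 < C N * U N / 2"
    using pos by (auto elim: eventually_mono)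
  have "(\<lambda>N. ln (C N) / real N + ln (U N) / real N - ln 2 / real N) \<longlonglongrightarrow> k + u - 0"
    by (intro tendsto_intros lim)
  then have "(\<lambda>N. ln (C N * U N / 2) / real N) \<longlonglongrightarrow> k + u - 0"
  proof (rule Lim_transform_eventually)
    show "\<forall>\<^sub>F N in sequentially. ln (C N) / real N + ln (U N) / real N - ln 2 / real N
        = ln (C N * U N / 2) / real N"
      using pos by eventually_elim (simp add: ln_mult ln_div add_divide_distrib diff_divide_distrib)
  qed
  then have "\<forall>\<^sub>F N in sequentially. exp (real N * l) \<le> C N * U N / 2"
    using less by (intro eventually_exp_le[OF _ p(4)]) auto
  then show ?thesis
    using eventually_negligible[OF lim(2) p(1) lim(3) p(2) less(1)]
      eventually_negligible[OF lim(2) p(1) lim(4) p(3) less(2)] assms(1) pos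
  proof eventually_elim
    case (elim N)
    have "C N * (U N / 2) \<le> C N * (U N - V N - W N)"
      using elim by (intro mult_left_mono) auto
    then have "C N * U N / 2 \<le> C N * (U N - V N - W N)" by simp
    then show ?case using elim by linarith
  qed
qed

lemma ln_limit_sandwich:
  fixes P W :: "nat \<Rightarrow> real"
  assumes upper: "\<forall>\<^sub>F N in sequentially. P N \<le> W N" "(\<lambda>N. ln (W N) / real N) \<longlonglongrightarrow> l"
    and lower: "\<And>\<zeta>. 0 < \<zeta> \<Longrightarrow> \<forall>\<^sub>F N in sequentially. exp (real N * (l - \<zeta>)) \<le> P N"
  shows "\<forall>\<^sub>F N in sequentially. 0 < P N" "(\<lambda>N. ln (P N) / real N) \<longlonglongrightarrow> l"
proof -
  show pos: "\<forall>\<^sub>F N in sequentially. 0 < P N"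
    using lower[of 1] by (auto elim!: eventually_mono intro: less_le_trans[OF exp_gt_zero])
  show "(\<lambda>N. ln (P N) / real N) \<longlonglongrightarrow> l"
  proof (rule order_tendstoI)
    fix x assume "x < l"
    then have "0 < (l - x) / 2" by simp
    from lower[OF this] pos eventually_gt_at_top[of 0]
    show "\<forall>\<^sub>F N in sequentially. x < ln (P N) / real N"
    proof eventually_elim
      case (elim N)
      have "ln (exp (real N * (l - (l - x) / 2))) \<le> ln (P N)"
        using elim by (subst ln_le_cancel_iff) auto
      then have "l - (l - x) / 2 \<le> ln (P N) / real N"
        using elim by (simp add: pos_le_divide_eq mult.commute)
      then show ?case using \<open>x < l\<close> by (simp add: field_simps)
    qed
  next
    fix x assume "l < x"
    from order_tendstoD(2)[OF upper(2) this] upper(1) pos eventually_gt_at_top[of 0]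
    show "\<forall>\<^sub>F N in sequentially. ln (P N) / real N < x"
    proof eventually_elim
      case (elim N)
      have "ln (P N) \<le> ln (W N)" using elim by (subst ln_le_cancel_iff) auto
      then have "ln (P N) / real N \<le> ln (W N) / real N" by (rule divide_right_mono) simp
      then show ?case using elim by linarith
    qed
  qed
qed

lemma
  fixes k :: "nat \<Rightarrow> nat"
  assumes c: "0 < c" and t: "0 \<le> t" and k: "(\<lambda>N. real (k N) / real N) \<longlonglongrightarrow> t"
    and pos: "0 < denom \<theta> (c * t)"
  shows eventually_mgf_pos: "\<forall>\<^sub>F N in sequentially. 0 < mgf (1 - c / real N) \<theta> (k N)"
    and ln_wave_limit: "(\<lambda>N. ln (wave (1 - c / real N) \<theta> N (k N)) / real N) \<longlonglongrightarrow> - rate c t \<theta>"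
proof -
  show mgf: "\<forall>\<^sub>F N in sequentially. 0 < mgf (1 - c / real N) \<theta> (k N)"
    using eventually_mgf_denom_pos[OF c t k pos]
    by eventually_elim (auto simp: mgf_def intro!: prod_pos)
  have "(\<lambda>N. - \<theta> + ln (mgf (1 - c / real N) \<theta> (k N)) / real N) \<longlonglongrightarrow> - \<theta> + - (Phi \<theta> (c * t) / c)"
    by (intro tendsto_intros ln_mgf_limit[OF c t k pos])
  then show "(\<lambda>N. ln (wave (1 - c / real N) \<theta> N (k N)) / real N) \<longlonglongrightarrow> - rate c t \<theta>"
    unfolding rate_def minus_add_distrib
  proof (rule Lim_transform_eventually)
    show "\<forall>\<^sub>F N in sequentially. - \<theta> + ln (mgf (1 - c / real N) \<theta> (k N)) / real N
        = ln (wave (1 - c / real N) \<theta> N (k N)) / real N"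
      using mgf eventually_gt_at_top[of 0]
      by eventually_elim (simp add: wave_def ln_mult add_divide_distrib diff_divide_distrib)
  qed
qed

lemma upper_tail_limit:
  fixes k :: "nat \<Rightarrow> nat"
  assumes c: "0 < c" and a: "a < 0" and t: "t = arrival c a"
    and k: "(\<lambda>N. real (k N) / real N) \<longlonglongrightarrow> t"
  defines "P N \<equiv> tail (1 - c / real N) N (k N)"
  shows "\<forall>\<^sub>F N in sequentially. 0 < P N" "(\<lambda>N. ln (P N) / real N) \<longlonglongrightarrow> - rate c t a"
proof -
  have a0: "a \<noteq> 0" using a by simp
  have t0: "0 \<le> t" using t_pos[OF c a0 t] by simp
  have d: "0 < denom \<theta> (c * t)" if "\<theta> \<le> a" for \<theta>
    using denom_antimono[OF that, of "c * t"] denom_t_pos[OF c a0 t] by linarith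
  have q: "\<forall>\<^sub>F N in sequentially. 0 < 1 - c / real N \<and> 1 - c / real N \<le> 1"
  proof -
    have "\<forall>\<^sub>F N in sequentially. c < real N" by real_asymp
    then show ?thesis by eventually_elim (use c in auto)
  qed
  note lim = ln_wave_limit[OF c t0 k d]
  have wpos: "\<forall>\<^sub>F N in sequentially. 0 < wave (1 - c / real N) \<theta> N (k N)" if "\<theta> \<le> a" for \<theta>
    using eventually_mgf_pos[OF c t0 k d[OF that]] by eventually_elim (simp add: wave_def)
  have upper: "\<forall>\<^sub>F N in sequentially. P N \<le> wave (1 - c / real N) a N (k N)"
    using q by eventually_elim (use a in \<open>auto simp: P_def intro!: tail_le_wave\<close>)
  have lower: "\<forall>\<^sub>F N in sequentially. exp (real N * (- rate c t a - \<zeta>)) \<le> P N" if "0 < \<zeta>" for \<zeta>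
  proof -
    \<comment> \<open>The cutoff is \<delta> N; as \<theta>1 will exceed a - 1, this choice keeps
      the cost |\<theta>1| \<delta> of the prefactor below \<zeta>.\<close>
    define \<delta> where "\<delta> = \<zeta> / (2 * (\<bar>a\<bar> + 1))"
    have \<delta>: "0 < \<delta>" "\<delta> * (\<bar>a\<bar> + 1) < \<zeta>" using that by (simp_all add: \<delta>_def field_simps add_pos_nonneg)
    \<comment> \<open>The weighted \<theta>2 wave is negligible against the main one when
      g(\<theta>2) < g(\<theta>1). As \<open>rate\<close> is stationary at a, g has slope \<delta> >
      0 there, which provides \<theta>2 < a with g(\<theta>2) < g(a).\<close>
    let ?g = "\<lambda>\<theta>. \<delta> * \<theta> - rate c t \<theta>"
    have g': "(?g has_real_derivative \<delta> - 0) (at a)"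
      by (intro DERIV_diff rate_derivative_0[OF c a0 t]) (auto intro!: derivative_eq_intros)
    then obtain h where h: "0 < h" "\<And>s. 0 < s \<Longrightarrow> s < h \<Longrightarrow> ?g (a - s) < ?g a"
      using DERIV_pos_inc_left[OF g'] \<delta> by auto
    define \<theta>2 where "\<theta>2 = a - h / 2"
    have \<theta>2: "\<theta>2 < a" "?g \<theta>2 < ?g a" using h by (auto simp: \<theta>2_def)
    \<comment> \<open>Continuity replaces a by some \<theta>1 < a; the inequality is strict so that
      the wave at a is negligible too.\<close>
    have "(?g \<longlongrightarrow> ?g a) (at_left a)"
      using DERIV_isCont[OF g'] by (simp add: isCont_def filterlim_at_split)
    then have "\<forall>\<^sub>F \<theta> in at_left a. ?g \<theta>2 < ?g \<theta>" using \<theta>2 by (intro order_tendstoD)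
    moreover have "\<forall>\<^sub>F \<theta> in at_left a. max \<theta>2 (a - 1) < \<theta> \<and> \<theta> < a"
      using eventually_at_left_real[of "max \<theta>2 (a - 1)" a] \<theta>2 by (auto elim: eventually_mono)
    ultimately have "\<forall>\<^sub>F \<theta> in at_left a. ?g \<theta>2 < ?g \<theta> \<and> max \<theta>2 (a - 1) < \<theta> \<and> \<theta> < a"
      by eventually_elim simp
    then obtain \<theta>1 where \<theta>1: "?g \<theta>2 < ?g \<theta>1" "\<theta>2 < \<theta>1" "a - 1 < \<theta>1" "\<theta>1 < a"
      using eventually_happens'[OF trivial_limit_at_left_real] by fastforce
    have "\<delta> * - \<theta>1 \<le> \<delta> * (\<bar>a\<bar> + 1)"
      using \<theta>1 \<delta> by (intro mult_left_mono) auto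
    then have small: "- \<zeta> < \<theta>1 * \<delta>" using \<delta> by (simp add: mult.commute)
    show ?thesis
    proof (rule eventually_exp_le_combination)
      show "\<forall>\<^sub>F N in sequentially. exp (\<theta>1 * (\<delta> * real N)) * (wave (1 - c / real N) \<theta>1 N (k N)
          - exp (- (\<theta>1 - \<theta>2) * (\<delta> * real N)) * wave (1 - c / real N) \<theta>2 N (k N)
          - wave (1 - c / real N) a N (k N)) \<le> P N"
        using q
      proof eventually_elim
        case (elim N)
        then show ?case
          unfolding P_def using \<theta>1 a by (intro wave_le_tail) auto
      qed
      show "\<forall>\<^sub>F N in sequentially. 0 < exp (\<theta>1 * (\<delta> * real N)) \<and> 0 < wave (1 - c / real N) \<theta>1 N (k N)
          \<and> 0 < exp (- (\<theta>1 - \<theta>2) * (\<delta> * real N)) * wave (1 - c / real N) \<theta>2 N (k N)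
          \<and> 0 < wave (1 - c / real N) a N (k N)"
        using wpos[OF less_imp_le[OF \<theta>1(4)]] wpos[OF less_imp_le[OF \<theta>2(1)]] wpos[OF order_refl]
        by eventually_elim simp
      show "(\<lambda>N. ln (exp (\<theta>1 * (\<delta> * real N))) / real N) \<longlonglongrightarrow> \<theta>1 * \<delta>"
        by (rule Lim_transform_eventually[OF tendsto_const])
          (use eventually_gt_at_top[of 0] in \<open>eventually_elim, simp\<close>)
      show "(\<lambda>N. ln (wave (1 - c / real N) \<theta>1 N (k N)) / real N) \<longlonglongrightarrow> - rate c t \<theta>1"
        using \<theta>1 by (intro lim) simp
      show "(\<lambda>N. ln (wave (1 - c / real N) a N (k N)) / real N) \<longlonglongrightarrow> - rate c t a"
        by (intro lim) simp
      have "(\<lambda>N. - (\<theta>1 - \<theta>2) * \<delta> + ln (wave (1 - c / real N) \<theta>2 N (k N)) / real N)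
          \<longlonglongrightarrow> - (\<theta>1 - \<theta>2) * \<delta> + - rate c t \<theta>2"
        by (intro tendsto_add tendsto_const lim) (use \<theta>2 in simp)
      then show "(\<lambda>N. ln (exp (- (\<theta>1 - \<theta>2) * (\<delta> * real N)) * wave (1 - c / real N) \<theta>2 N (k N)) / real N)
          \<longlonglongrightarrow> - (\<theta>1 - \<theta>2) * \<delta> + - rate c t \<theta>2"
      proof (rule Lim_transform_eventually)
        show "\<forall>\<^sub>F N in sequentially. - (\<theta>1 - \<theta>2) * \<delta> + ln (wave (1 - c / real N) \<theta>2 N (k N)) / real N
            = ln (exp (- (\<theta>1 - \<theta>2) * (\<delta> * real N)) * wave (1 - c / real N) \<theta>2 N (k N)) / real N"
          using wpos[OF less_imp_le[OF \<theta>2(1)]] eventually_gt_at_top[of 0]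
          by eventually_elim (simp add: ln_mult add_divide_distrib)
      qed
      show "- (\<theta>1 - \<theta>2) * \<delta> + - rate c t \<theta>2 < - rate c t \<theta>1"
        using \<theta>1(1) by (simp add: algebra_simps)
      show "- rate c t a < - rate c t \<theta>1"
        using rate_less_left[OF c a0 t \<theta>1(4) a] by simp
      then show "- rate c t a - \<zeta> < \<theta>1 * \<delta> + - rate c t \<theta>1"
        using small by simp
    qed
  qed
  show "\<forall>\<^sub>F N in sequentially. 0 < P N" "(\<lambda>N. ln (P N) / real N) \<longlonglongrightarrow> - rate c t a"
    by (rule ln_limit_sandwich[OF upper lim lower]; simp)+
qed

lemma lower_tail_limit:
  fixes k :: "nat \<Rightarrow> nat"
  assumes c: "0 < c" and a: "0 < a" and t: "t = arrival c a"
    and k: "(\<lambda>N. real (k N) / real N) \<longlonglongrightarrow> t" and floor: "\<And>N. nat \<lfloor>t * real N\<rfloor> \<le> k N"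
  defines "P N \<equiv> 1 - tail (1 - c / real N) N (k N)"
  shows "\<forall>\<^sub>F N in sequentially. 0 < P N" "(\<lambda>N. ln (P N) / real N) \<longlonglongrightarrow> - rate c t a"
proof -
  have a0: "a \<noteq> 0" using a by simp
  have tpos: "0 < t" by (rule t_pos[OF c a0 t])
  then have t0: "0 \<le> t" by simp
  \<comment> \<open>For positive tilts the estimates need \<open>denom\<close> to be positive;
    \<theta>m marks the room to the right of a in which \<theta>1 and \<theta>2 are chosen.\<close>
  obtain \<theta>m where \<theta>m: "a < \<theta>m" "0 < denom \<theta>m (c * t)"
    by (rule denom_pos_larger_theta[OF denom_t_pos[OF c a0 t]])
  have d: "0 < denom \<theta> (c * t)" if "\<theta> \<le> \<theta>m" for \<theta>
    using denom_antimono[OF that, of "c * t"] \<theta>m by linarith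
  have q: "\<forall>\<^sub>F N in sequentially. 0 < 1 - c / real N \<and> 1 - c / real N \<le> 1"
  proof -
    have "\<forall>\<^sub>F N in sequentially. c < real N" by real_asymp
    then show ?thesis by eventually_elim (use c in auto)
  qed
  note lim = ln_wave_limit[OF c t0 k d]
  have wpos: "\<forall>\<^sub>F N in sequentially. 0 < wave (1 - c / real N) \<theta> N (k N)" if "\<theta> \<le> \<theta>m" for \<theta>
    using eventually_mgf_pos[OF c t0 k d[OF that]] by eventually_elim (simp add: wave_def)
  have upper: "\<forall>\<^sub>F N in sequentially. P N \<le> wave (1 - c / real N) a N (k N)"
    using q eventually_mgf_denom_pos[OF c t0 k d[OF less_imp_le[OF \<theta>m(1)]]]
    by eventually_elim (use a in \<open>auto simp: P_def intro!: head_le_wave\<close>)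
  have lower: "\<forall>\<^sub>F N in sequentially. exp (real N * (- rate c t a - \<zeta>)) \<le> P N" if "0 < \<zeta>" for \<zeta>
  proof -
    \<comment> \<open>The cutoff s is taken so small that dividing by \<open>mgf\<close> at index
      \<open>i N\<close> costs less than \<zeta> in the exponent: \<open>Phi a\<close> is continuous
      and vanishes at 0.\<close>
    have "continuous_on {0..c * t} (Phi a)"
      using Phi_derivative_x[OF denom_t_pos[OF c a0 t]] by (intro DERIV_continuous_on)
    then have "continuous_on {0..t} (\<lambda>s. Phi a (c * s))"
      by (rule continuous_on_compose2) (use c in \<open>auto intro!: continuous_intros\<close>)
    then have "continuous_on {0..t} (\<lambda>s. - (Phi a (c * s) / c))"
      by (intro continuous_intros) (use c in auto)
    then have "((\<lambda>s. - (Phi a (c * s) / c)) \<longlongrightarrow> - (Phi a (c * 0) / c)) (at 0 within {0..t})"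
      by (rule continuous_on_def[THEN iffD1, rule_format]) (use t0 in simp)
    then have "((\<lambda>s. - (Phi a (c * s) / c)) \<longlongrightarrow> 0) (at_right 0)"
      using tpos by (simp add: at_within_Icc_at_right)
    then have "\<forall>\<^sub>F s in at_right 0. - (Phi a (c * s) / c) < \<zeta>"
      using that by (rule order_tendstoD(2))
    moreover have "\<forall>\<^sub>F s in at_right 0. 0 < s \<and> s < t"
      using eventually_at_right_real[OF tpos] by (auto elim: eventually_mono)
    ultimately have "\<forall>\<^sub>F s in at_right 0. - (Phi a (c * s) / c) < \<zeta> \<and> 0 < s \<and> s < t"
      by eventually_elim simp
    then obtain s where s: "- (Phi a (c * s) / c) < \<zeta>" "0 < s" "s < t"
      using eventually_happens'[OF trivial_limit_at_right_real] by blast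
    have ds: "0 < denom \<theta> (c * s)" if "\<theta> \<le> \<theta>m" for \<theta>
      by (rule denom_pos[OF d[OF that]]) (use s c in auto)
    have cs: "0 \<le> c * s" using s c by simp
    define i where "i N = nat \<lfloor>s * real N\<rfloor>" for N
    have i: "(\<lambda>N. real (i N) / real N) \<longlonglongrightarrow> s"
      unfolding i_def using s(2) by real_asymp
    have ik: "i N \<le> k N" for N
    proof -
      have "i N \<le> nat \<lfloor>t * real N\<rfloor>"
        unfolding i_def using s(3) by (intro nat_mono floor_mono mult_right_mono) auto
      then show ?thesis using floor[of N] by linarith
    qed
    let ?L = "\<lambda>\<theta>. Phi \<theta> (c * s) / c"
    \<comment> \<open>Here the cutoff contributes \<open>?L\<close>. As \<open>rate\<close> is
      stationary at a, the derivative of g there is that of \<open>?L\<close>, which is negative, so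
      \<theta>2 is found to the right of a.\<close>
    let ?g = "\<lambda>\<theta>. - rate c t \<theta> + ?L \<theta>"
    let ?w = "1 - exp a"
    define r where "r = (ln (denom a (c * s)) + a) / ?w / c"
    have L': "(?L has_real_derivative - r) (at a)"
      using DERIV_cdivide[OF Phi_derivative_theta[OF ds[OF less_imp_le[OF \<theta>m(1)]] cs a0], of c]
      by (simp add: r_def)
    have "ln (1 + ?w * (exp (c * s) - 1)) < 0"
    proof (rule ln_less_zero)
      show "0 < 1 + ?w * (exp (c * s) - 1)"
        using ds[OF less_imp_le[OF \<theta>m(1)]] by (simp flip: scaled_denom)
      show "1 + ?w * (exp (c * s) - 1) < 1"
        using a s c by (simp add: mult_neg_pos)
    qed
    then have "ln (denom a (c * s)) + a < 0"
      using ln_scaled_denom[OF ds[OF less_imp_le[OF \<theta>m(1)]]] by simp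
    then have r: "0 < r"
      using a c by (simp add: r_def zero_less_divide_iff mult_less_0_iff)
    have g': "(?g has_real_derivative - 0 + - r) (at a)"
      by (intro DERIV_add DERIV_minus L' rate_derivative_0[OF c a0 t])
    then obtain h where h: "0 < h" "\<And>x. 0 < x \<Longrightarrow> x < h \<Longrightarrow> ?g (a + x) < ?g a"
      using DERIV_neg_dec_right[OF g'] r by auto
    \<comment> \<open>Capped at \<theta>m to keep \<open>denom\<close> positive.\<close>
    define \<theta>2 where "\<theta>2 = a + min (h / 2) (\<theta>m - a)"
    have \<theta>2: "a < \<theta>2" "\<theta>2 \<le> \<theta>m" "?g \<theta>2 < ?g a"
      using h(1) h(2)[of "min (h / 2) (\<theta>m - a)"] \<theta>m by (auto simp: \<theta>2_def min_less_iff_disj)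
    have "(?g \<longlongrightarrow> ?g a) (at_right a)"
      using DERIV_isCont[OF g'] unfolding isCont_def filterlim_at_split by blast
    then have "\<forall>\<^sub>F \<theta> in at_right a. ?g \<theta>2 < ?g \<theta>"
      using \<theta>2(3) by (rule order_tendstoD(1))
    moreover have "((\<lambda>\<theta>. - ?L \<theta>) \<longlongrightarrow> - ?L a) (at_right a)"
      by (rule tendsto_minus[OF conjunct2[OF DERIV_isCont[OF L', unfolded isCont_def filterlim_at_split]]])
    then have "\<forall>\<^sub>F \<theta> in at_right a. - ?L \<theta> < \<zeta>"
      using s(1) by (rule order_tendstoD(2))
    moreover have "\<forall>\<^sub>F \<theta> in at_right a. a < \<theta> \<and> \<theta> < \<theta>2"
      using eventually_at_right_real[OF \<theta>2(1)] by (auto elim: eventually_mono)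
    ultimately have "\<forall>\<^sub>F \<theta> in at_right a. ?g \<theta>2 < ?g \<theta> \<and> - ?L \<theta> < \<zeta> \<and> a < \<theta> \<and> \<theta> < \<theta>2"
      by eventually_elim simp
    then obtain \<theta>1 where \<theta>1: "?g \<theta>2 < ?g \<theta>1" "- ?L \<theta>1 < \<zeta>" "a < \<theta>1" "\<theta>1 < \<theta>2"
      using eventually_happens'[OF trivial_limit_at_right_real] by blast
    have s0: "0 \<le> s" using s by simp
    note lim_i = ln_mgf_limit[OF c s0 i ds]
    have ipos: "\<forall>\<^sub>F N in sequentially. 0 < mgf (1 - c / real N) \<theta> (i N)" if "\<theta> \<le> \<theta>m" for \<theta>
      by (rule eventually_mgf_pos[OF c s0 i ds[OF that]])
    have le: "\<theta>1 \<le> \<theta>m" "a \<le> \<theta>m" using \<theta>1 \<theta>2 by auto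
    let ?R = "\<lambda>N. mgf (1 - c / real N) \<theta>1 (i N) / mgf (1 - c / real N) \<theta>2 (i N)"
    show ?thesis
    proof (rule eventually_exp_le_combination)
      show "\<forall>\<^sub>F N in sequentially. inverse (mgf (1 - c / real N) \<theta>1 (i N)) * (wave (1 - c / real N) \<theta>1 N (k N)
          - wave (1 - c / real N) a N (k N) - ?R N * wave (1 - c / real N) \<theta>2 N (k N)) \<le> P N"
        using q eventually_mgf_denom_pos[OF c t0 k d[OF \<theta>2(2)]]
      proof eventually_elim
        case (elim N)
        have "(wave (1 - c / real N) \<theta>1 N (k N) - wave (1 - c / real N) a N (k N)
            - ?R N * wave (1 - c / real N) \<theta>2 N (k N)) / mgf (1 - c / real N) \<theta>1 (i N) \<le> P N"
          unfolding P_def using elim \<theta>1 a ik[of N] by (intro wave_le_head) auto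
        then show ?case by (simp add: divide_inverse mult.commute)
      qed
      show "\<forall>\<^sub>F N in sequentially. 0 < inverse (mgf (1 - c / real N) \<theta>1 (i N))
          \<and> 0 < wave (1 - c / real N) \<theta>1 N (k N) \<and> 0 < wave (1 - c / real N) a N (k N)
          \<and> 0 < ?R N * wave (1 - c / real N) \<theta>2 N (k N)"
        using ipos[OF le(1)] ipos[OF \<theta>2(2)] wpos[OF le(1)] wpos[OF le(2)] wpos[OF \<theta>2(2)]
        by eventually_elim simp
      have "(\<lambda>N. - (ln (mgf (1 - c / real N) \<theta>1 (i N)) / real N)) \<longlonglongrightarrow> - (- ?L \<theta>1)"
        by (intro tendsto_minus lim_i le)
      then show "(\<lambda>N. ln (inverse (mgf (1 - c / real N) \<theta>1 (i N))) / real N) \<longlonglongrightarrow> ?L \<theta>1"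
        by (simp add: ln_inverse)
      show "(\<lambda>N. ln (wave (1 - c / real N) \<theta>1 N (k N)) / real N) \<longlonglongrightarrow> - rate c t \<theta>1"
        by (intro lim le)
      show "(\<lambda>N. ln (wave (1 - c / real N) a N (k N)) / real N) \<longlonglongrightarrow> - rate c t a"
        by (intro lim le)
      have "(\<lambda>N. ln (mgf (1 - c / real N) \<theta>1 (i N)) / real N - ln (mgf (1 - c / real N) \<theta>2 (i N)) / real N
          + ln (wave (1 - c / real N) \<theta>2 N (k N)) / real N)
          \<longlonglongrightarrow> - ?L \<theta>1 - (- ?L \<theta>2) + - rate c t \<theta>2"
        by (intro tendsto_add tendsto_diff lim_i lim le \<theta>2(2))
      then show "(\<lambda>N. ln (?R N * wave (1 - c / real N) \<theta>2 N (k N)) / real N)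
          \<longlonglongrightarrow> - ?L \<theta>1 - (- ?L \<theta>2) + - rate c t \<theta>2"
      proof (rule Lim_transform_eventually)
        show "\<forall>\<^sub>F N in sequentially. ln (mgf (1 - c / real N) \<theta>1 (i N)) / real N
              - ln (mgf (1 - c / real N) \<theta>2 (i N)) / real N + ln (wave (1 - c / real N) \<theta>2 N (k N)) / real N
            = ln (?R N * wave (1 - c / real N) \<theta>2 N (k N)) / real N"
          using ipos[OF le(1)] ipos[OF \<theta>2(2)] wpos[OF \<theta>2(2)]
          by eventually_elim (simp add: ln_mult ln_div add_divide_distrib diff_divide_distrib)
      qed
      show "- ?L \<theta>1 - (- ?L \<theta>2) + - rate c t \<theta>2 < - rate c t \<theta>1"
        using \<theta>1(1) by linarith
      show "- rate c t a < - rate c t \<theta>1"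
        using rate_less_right[OF c a0 t a \<theta>1(3) d[OF le(1)]] by simp
      then show "- rate c t a - \<zeta> < ?L \<theta>1 + - rate c t \<theta>1"
        using \<theta>1(2) by linarith
    qed
  qed
  show "\<forall>\<^sub>F N in sequentially. 0 < P N" "(\<lambda>N. ln (P N) / real N) \<longlonglongrightarrow> - rate c t a"
    by (rule ln_limit_sandwich[OF upper lim[OF less_imp_le[OF \<theta>m(1)]] lower]; simp)+
qed

section \<open>Existence and uniqueness of the optimal parameter\<close>

lemma arrival_inj:
  assumes c: "0 < c" and "arrival c a = arrival c b"
  shows "a = b"
proof -
  have "slope c (1 - exp a) = slope c (1 - exp b)"
    using assms(2) exp_arrival[OF c, of a] exp_arrival[OF c, of b] by simp
  then show ?thesis unfolding slope_eq_iff[OF c] by simp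
qed

text \<open>The threshold ln(1 + c)/c corresponds to slope c, that is w = 0, and t < 1 to w < 1;
  then a = ln(1 - w).\<close>

lemma arrival_surj_neg:
  assumes c: "0 < c" and "ln (1 + c) / c < t" "t < 1"
  shows "\<exists>a<0. arrival c a = t"
proof -
  have "ln (1 + c) < c * t" using assms by (simp add: pos_divide_less_eq mult.commute)
  then have "exp (ln (1 + c)) < exp (c * t)" by simp
  then have "c < exp (c * t) - 1" using c by simp
  moreover have "exp (c * t) - 1 < exp c - 1" using assms by simp
  ultimately obtain w where w: "0 < w" "w < 1" "slope c w = exp (c * t) - 1"
    using slope_surj_pos[OF c] by blast
  then show ?thesis
    by (intro exI[of _ "ln (1 - w)"]) (simp add: arrival_eq_iff[OF c])
qed

lemma arrival_surj_pos:
  assumes c: "0 < c" and "0 < t" "t < ln (1 + c) / c"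
  shows "\<exists>a>0. arrival c a = t"
proof -
  have "c * t < ln (1 + c)" using assms by (simp add: pos_less_divide_eq mult.commute)
  then have "exp (c * t) < exp (ln (1 + c))" by simp
  then have "exp (c * t) - 1 < c" using c by simp
  moreover have "0 < exp (c * t) - 1" using assms by simp
  ultimately obtain w where w: "w < 0" "slope c w = exp (c * t) - 1"
    using slope_surj_neg[OF c] by blast
  then show ?thesis
    by (intro exI[of _ "ln (1 - w)"]) (simp add: arrival_eq_iff[OF c])
qed

lemma scaled_log_prob_limit:
  fixes M :: "nat \<Rightarrow> 'a pmf"
  assumes "\<forall>\<^sub>F N in sequentially. measure_pmf.prob (M N) (A N) = P N"
    and "\<forall>\<^sub>F N in sequentially. 0 < P N" "(\<lambda>N. ln (P N) / real N) \<longlonglongrightarrow> - l"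
  shows "(\<lambda>N. ereal (1 / real N) * log_prob (M N) (A N)) \<longlonglongrightarrow> - ereal l"
proof -
  have "(\<lambda>N. ereal (ln (P N) / real N)) \<longlonglongrightarrow> - ereal l"
    using assms(3) by simp
  then show ?thesis
  proof (rule Lim_transform_eventually)
    show "\<forall>\<^sub>F N in sequentially. ereal (ln (P N) / real N) = ereal (1 / real N) * log_prob (M N) (A N)"
      using assms(1,2) by eventually_elim (simp add: log_prob_def)
  qed
qed

theorem theorem2p6:
  fixes c Tstar :: real
  assumes "c > 0"
    and "Tstar = 1 / c * ln (1 + c)"
  shows "(\<forall>\<epsilon>>0. Tstar + \<epsilon> < 1 \<longrightarrow>
      (\<exists>!a. a < 0 \<and> hit_time c a = Tstar + \<epsilon>) \<and>
      (\<lambda>N::nat. ereal (1 / real N) *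
          log_prob (greedy_exploration N (c / real N))
            {ss. real (stop_time N ss) / real N \<ge> Tstar + \<epsilon>})
        \<longlonglongrightarrow> - path_cost c (THE a. a < 0 \<and> hit_time c a = Tstar + \<epsilon>)) \<and>
    (\<forall>\<epsilon>>0. Tstar - \<epsilon> > 0 \<longrightarrow>
      (\<exists>!a. a > 0 \<and> hit_time c a = Tstar - \<epsilon>) \<and>
      (\<lambda>N::nat. ereal (1 / real N) *
          log_prob (greedy_exploration N (c / real N))
            {ss. real (stop_time N ss) / real N \<le> Tstar - \<epsilon>})
        \<longlonglongrightarrow> - path_cost c (THE a. a > 0 \<and> hit_time c a = Tstar - \<epsilon>))"
proof (intro conjI allI impI)
  have Tstar: "Tstar = ln (1 + c) / c" using assms(2) by simp
  have large: "\<forall>\<^sub>F N in sequentially. c \<le> real N" by real_asymp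
  note c = assms(1)
  {
    fix \<epsilon> :: real assume "\<epsilon> > 0" "Tstar + \<epsilon> < 1"
    define t where "t = Tstar + \<epsilon>"
    have t: "ln (1 + c) / c < t" "t < 1" using \<open>\<epsilon> > 0\<close> \<open>Tstar + \<epsilon> < 1\<close> by (auto simp: t_def Tstar)
    obtain a where a: "a < 0" "arrival c a = t"
      using arrival_surj_neg[OF c t] by blast
    have iff: "b < 0 \<and> hit_time c b = t \<longleftrightarrow> b = a" for b
    proof
      assume b: "b < 0 \<and> hit_time c b = t"
      then have "arrival c b = arrival c a" using a(2) hit_time_eq[OF c, of b] by simp
      then show "b = a" by (rule arrival_inj[OF c])
    next
      assume "b = a"
      then show "b < 0 \<and> hit_time c b = t" using a hit_time_eq[OF c, of a] by simp
    qed
    then show "\<exists>!a. a < 0 \<and> hit_time c a = Tstar + \<epsilon>" by (simp flip: t_def)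
    have "0 < t" using t_pos[OF c _ a(2)[symmetric]] a by simp
    \<comment> \<open>An integer is at least t N exactly when it is at least the ceiling.\<close>
    define k where "k N = nat \<lceil>t * real N\<rceil>" for N
    have k: "(\<lambda>N. real (k N) / real N) \<longlonglongrightarrow> t"
      unfolding k_def using \<open>0 < t\<close> by real_asymp
    have "\<forall>\<^sub>F N in sequentially. measure_pmf.prob (greedy_exploration N (c / real N))
        {ss. real (stop_time N ss) / real N \<ge> t} = tail (1 - c / real N) N (k N)"
      using large eventually_gt_at_top[of 0]
    proof eventually_elim
      case (elim N)
      have "{ss. real (stop_time N ss) / real N \<ge> t} = {ss. k N \<le> stop_time N ss}"
        using elim by (auto simp: k_def pos_le_divide_eq ceiling_le_iff nat_le_iff)
      moreover have "t * real N \<le> 1 * real N" using t by (intro mult_right_mono) auto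
      then have "k N \<le> N" by (simp add: k_def nat_le_iff ceiling_le_iff)
      ultimately show ?case
        using elim c by (simp add: prob_stop_time_eq_tail)
    qed
    from scaled_log_prob_limit[OF this upper_tail_limit[OF c a(1) a(2)[symmetric] k]]
    show "(\<lambda>N::nat. ereal (1 / real N) * log_prob (greedy_exploration N (c / real N))
            {ss. real (stop_time N ss) / real N \<ge> Tstar + \<epsilon>})
        \<longlonglongrightarrow> - path_cost c (THE a. a < 0 \<and> hit_time c a = Tstar + \<epsilon>)"
      using a by (simp add: iff path_cost_eq[OF c] rate_def flip: t_def)
  }
  {
    fix \<epsilon> :: real assume "\<epsilon> > 0" "Tstar - \<epsilon> > 0"
    define t where "t = Tstar - \<epsilon>"
    have t: "0 < t" "t < ln (1 + c) / c" using \<open>\<epsilon> > 0\<close> \<open>Tstar - \<epsilon> > 0\<close> by (auto simp: t_def Tstar)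
    obtain a where a: "0 < a" "arrival c a = t"
      using arrival_surj_pos[OF c t] by blast
    have iff: "b > 0 \<and> hit_time c b = t \<longleftrightarrow> b = a" for b
    proof
      assume b: "b > 0 \<and> hit_time c b = t"
      then have "arrival c b = arrival c a" using a(2) hit_time_eq[OF c, of b] by simp
      then show "b = a" by (rule arrival_inj[OF c])
    next
      assume "b = a"
      then show "b > 0 \<and> hit_time c b = t" using a hit_time_eq[OF c, of a] by simp
    qed
    then show "\<exists>!a. a > 0 \<and> hit_time c a = Tstar - \<epsilon>" by (simp flip: t_def)
    have "t < 1" using arrival_less_1[OF c, of a] a by simp
    \<comment> \<open>One more than the floor, so that a stopping time at most t N is the complement
      of one at least \<open>k N\<close>. That \<open>k N\<close> still does not exceed N, as the
      tail formula demands, is due to t < 1.\<close>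
    define k where "k N = nat \<lfloor>t * real N\<rfloor> + 1" for N
    have k: "(\<lambda>N. real (k N) / real N) \<longlonglongrightarrow> t"
      unfolding k_def using t(1) by real_asymp
    have "\<forall>\<^sub>F N in sequentially. measure_pmf.prob (greedy_exploration N (c / real N))
        {ss. real (stop_time N ss) / real N \<le> t} = 1 - tail (1 - c / real N) N (k N)"
      using large eventually_gt_at_top[of 0]
    proof eventually_elim
      case (elim N)
      have "0 \<le> t * real N" using t by simp
      have "real m / real N \<le> t \<longleftrightarrow> \<not> k N \<le> m" for m
      proof -
        have "real m / real N \<le> t \<longleftrightarrow> real m \<le> t * real N"
          using elim by (simp add: pos_divide_le_eq)
        also have "\<dots> \<longleftrightarrow> m \<le> nat \<lfloor>t * real N\<rfloor>"
          using \<open>0 \<le> t * real N\<close> by (simp add: le_nat_iff le_floor_iff)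
        finally show ?thesis unfolding k_def by linarith
      qed
      then have eq: "{ss. real (stop_time N ss) / real N \<le> t} = - {ss. k N \<le> stop_time N ss}"
        by blast
      have "t * real N < 1 * real N" using \<open>t < 1\<close> elim by (intro mult_strict_right_mono) auto
      then have "\<lfloor>t * real N\<rfloor> < int N" by (simp add: floor_less_iff)
      then have "k N \<le> N" using elim(2) unfolding k_def by arith
      moreover have "c / real N \<in> {0..1}" using elim c by simp
      ultimately have "measure_pmf.prob (greedy_exploration N (c / real N)) {ss. k N \<le> stop_time N ss}
          = tail (1 - c / real N) N (k N)"
        by (rule prob_stop_time_eq_tail)
      then show ?case
        unfolding eq Compl_eq_Diff_UNIV
        using measure_pmf.prob_compl[of "{ss. k N \<le> stop_time N ss}" "greedy_exploration N (c / real N)"]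
        by simp
    qed
    moreover have "nat \<lfloor>t * real N\<rfloor> \<le> k N" for N by (simp add: k_def)
    note lower_tail_limit[OF c a(1) a(2)[symmetric] k this]
    ultimately have "(\<lambda>N. ereal (1 / real N) * log_prob (greedy_exploration N (c / real N))
        {ss. real (stop_time N ss) / real N \<le> t}) \<longlonglongrightarrow> - ereal (rate c t a)"
      by (rule scaled_log_prob_limit)
    then show "(\<lambda>N::nat. ereal (1 / real N) * log_prob (greedy_exploration N (c / real N))
            {ss. real (stop_time N ss) / real N \<le> Tstar - \<epsilon>})
        \<longlonglongrightarrow> - path_cost c (THE a. a > 0 \<and> hit_time c a = Tstar - \<epsilon>)"
      using a by (simp add: iff path_cost_eq[OF c] rate_def flip: t_def)
  }
qed

end
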